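(* In the (formal, degreewise finite) tensor representation of the identity map of $\mathbb R\langle\mathbb A\rangle$ one has $$\mathrm{Id}=\sum_{w\in\mathbb A^*}w\otimes\overline w=\sum_{w^0\in(\mathbb A^0)^*}w^0\otimes\overline w^0 .$$ Further, in the basis $(\mathbb A^0)^*$ of $\mathbb R\langle\mathbb A\rangle$ the quasi-shuffle product $\star$ is given by the shuffle product: for all $a_1,\dots,a_{n+m}\in\mathbb A$, $$(a_1^0\cdots a_n^0)\star(a_{n+1}^0\cdots a_{n+m}^0)=\sum_{\sigma\in Sh(n,m)}a^0_{\sigma(1)}\cdots a^0_{\sigma(n+m)},$$ where $Sh(n,m)$ is the set of permutations $\sigma$ of $\{1,\dots,n+m\}$ with $\sigma^{-1}(1)<\cdots<\sigma^{-1}(n)$ and $\sigma^{-1}(n+1)<\cdots<\sigma^{-1}(n+m)$.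
   Context: Fix $0\le d\le\ell$. Alphabet: $\mathbb A=\{0,1,\dots,\ell\}\cup\{i^{(2)}:1\le i\le d\}\cup\{i^{(m)}:d+1\le i\le\ell,\ m\ge2\}$, with $i^{(1)}:=i$; $\mathbb A^*$ is the set of words, $\mathbf 1$ the empty word, $\mathbb R\langle\mathbb A\rangle$ the linear span of $\mathbb A^*$. Bracket product: the commutative associative bilinear product on the span of $\mathbb A$ with $[0,a]=0$ for all letters $a$; $[i,i]=i^{(2)}$, $[i,i^{(2)}]=0$ for $1\le i\le d$; $[i^{(p)},i^{(q)}]=i^{(p+q)}$ for $d+1\le i\le\ell$; $[i^{(p)},j^{(q)}]=0$ for $i\neq j$. Iterated: $[a_1,\dots,a_n]=[a_1,[a_2,\dots,a_n]]$. Quasi-shuffle product $\star$ on $\mathbb R\langle\mathbb A\rangle$: $u\star\mathbf 1=\mathbf 1\star u=u$ and $ua\star vb=(u\star vb)a+(ua\star v)b+(u\star v)[a,b]$ for words $u,v$ and letters $a,b$. Let $\overline{\mathbb A}=\{\overline a\}$ be a copy of $\mathbb A$ and $\mathbb R\langle\overline{\mathbb A}\rangle$ the free associative algebra on it. $\overline a^0:=\sum_{n\ge1}\frac{(-1)^{n-1}}n\sum_{[a_1,\dots,a_n]=a}\overline a_1\cdots\overline a_n$ (sum over letters $a_i\in\mathbb A$); for $w=a_1\cdots a_n$, $\overline w^0:=\overline a^0_1\cdots\overline a^0_n$. The $\overline w^0$ form a basis of $\mathbb R\langle\overline{\mathbb A}\rangle$. $(\mathbb A^0)^*$ denotes the dual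 basis of $\mathbb R\langle\mathbb A\rangle$ for the pairing $\langle w,\overline{w'}\rangle=\delta_{w=w'}$; its element dual to $\overline w^0=\overline a_1^0\cdots\overline a_n^0$ is written $w^0=a_1^0\cdots a_n^0$ (this is notation for a dual basis element, not a concatenation product of elements of $\mathbb R\langle\mathbb A\rangle$). A tensor $x\otimes\overline y$ is viewed as the endomorphism $z\mapsto\langle z,\overline y\rangle x$ of $\mathbb R\langle\mathbb A\rangle$. *)

theory Defs
  imports "HOL-Analysis.Finite_Function_Topology" "HOL-Combinatorics.Permutations"
begin

text \<open>
  Words form the free monoid, written additively because the convolution product of
  \<^typ>\<open>'a \<Rightarrow>\<^sub>0 'b\<close> expects an additive monoid of exponents. Thus
  \<^typ>\<open>'a list \<Rightarrow>\<^sub>0 real\<close> is the free associative algebra on \<^typ>\<open>'a\<close>, its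
  product being the bilinear extension of concatenation.
\<close>

instantiation list :: (type) monoid_add
begin

definition zero_list :: "'a list" where "zero_list = []"

definition plus_list :: "'a list \<Rightarrow> 'a list \<Rightarrow> 'a list" where "plus_list u v = u @ v"

instance by standard (simp_all add: zero_list_def plus_list_def)

end

text \<open>\<open>Letter i m\<close> is $i^{(m)}$; in particular \<open>Letter i 1\<close> is the letter $i$.\<close>

datatype letter = Letter (index: nat) (level: nat)

definition alphabet :: "nat \<Rightarrow> nat \<Rightarrow> letter set" where
  "alphabet d l = {Letter i 1 |i. i \<le> l}
     \<union> {Letter i 2 |i. 1 \<le> i \<and> i \<le> d}
     \<union> {Letter i m |i m. d + 1 \<le> i \<and> i \<le> l \<and> 2 \<le> m}"

definition words :: "nat \<Rightarrow> nat \<Rightarrow> letter list set" where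
  "words d l = lists (alphabet d l)"

text \<open>
  The type \<^typ>\<open>letter\<close> does not depend on \<open>d\<close> and \<open>l\<close>, so
  $\mathbb{R}\langle\mathbb{A}\rangle$ is a subspace of \<^typ>\<open>letter list \<Rightarrow>\<^sub>0 real\<close>.
\<close>

definition word_space :: "nat \<Rightarrow> nat \<Rightarrow> (letter list \<Rightarrow>\<^sub>0 real) set" where
  "word_space d l = {x. Poly_Mapping.keys x \<subseteq> words d l}"

definition word_vec :: "'a list \<Rightarrow> ('a list \<Rightarrow>\<^sub>0 real)" where
  "word_vec w = Poly_Mapping.single w 1"

definition bilinear_ext ::
  "('a \<Rightarrow> 'b \<Rightarrow> 'c::real_vector) \<Rightarrow> ('a \<Rightarrow>\<^sub>0 real) \<Rightarrow> ('b \<Rightarrow>\<^sub>0 real) \<Rightarrow> 'c" where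
  "bilinear_ext B x y = (\<Sum>a\<in>Poly_Mapping.keys x. \<Sum>b\<in>Poly_Mapping.keys y.
     (Poly_Mapping.lookup x a * Poly_Mapping.lookup y b) *\<^sub>R B a b)"

text \<open>
  For \<open>1 \<le> i \<le> d\<close> the only nonzero bracket is $[i,i]=i^{(2)}$; that
  $[i^{(2)},i^{(2)}]=0$ follows from $[i,i^{(2)}]=0$ by associativity.
\<close>

fun letter_bracket :: "nat \<Rightarrow> letter \<Rightarrow> letter \<Rightarrow> (letter \<Rightarrow>\<^sub>0 real)" where
  "letter_bracket d (Letter i p) (Letter j q) =
     (if i = j \<and> (1 \<le> i \<and> i \<le> d \<and> p = 1 \<and> q = 1 \<or> d + 1 \<le> i)
      then Poly_Mapping.single (Letter i (p + q)) 1 else 0)"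

definition bracket ::
  "nat \<Rightarrow> (letter \<Rightarrow>\<^sub>0 real) \<Rightarrow> (letter \<Rightarrow>\<^sub>0 real) \<Rightarrow> (letter \<Rightarrow>\<^sub>0 real)" where
  "bracket d = bilinear_ext (letter_bracket d)"

text \<open>The value on the empty list is junk and never used.\<close>

fun iter_bracket :: "nat \<Rightarrow> letter list \<Rightarrow> (letter \<Rightarrow>\<^sub>0 real)" where
  "iter_bracket d [] = 0"
| "iter_bracket d [a] = Poly_Mapping.single a 1"
| "iter_bracket d (a # b # w) = bracket d (Poly_Mapping.single a 1) (iter_bracket d (b # w))"

definition letters_to_words :: "('a \<Rightarrow>\<^sub>0 real) \<Rightarrow> ('a list \<Rightarrow>\<^sub>0 real)" where
  "letters_to_words x = (\<Sum>a\<in>Poly_Mapping.keys x. Poly_Mapping.lookup x a *\<^sub>R word_vec [a])"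

function word_qshuffle :: "nat \<Rightarrow> letter list \<Rightarrow> letter list \<Rightarrow> (letter list \<Rightarrow>\<^sub>0 real)" where
  "word_qshuffle d u [] = word_vec u"
| "word_qshuffle d [] v = word_vec v"
| "word_qshuffle d (u @ [a]) (v @ [b]) =
     word_qshuffle d u (v @ [b]) * word_vec [a]
     + word_qshuffle d (u @ [a]) v * word_vec [b]
     + word_qshuffle d u v * letters_to_words (letter_bracket d a b)"
proof -
  fix P :: bool and x :: "nat \<times> letter list \<times> letter list"
  assume 1: "\<And>d u. x = (d, u, []) \<Longrightarrow> P"
    and 2: "\<And>d v. x = (d, [], v) \<Longrightarrow> P"
    and 3: "\<And>d u a v b. x = (d, u @ [a], v @ [b]) \<Longrightarrow> P"
  obtain d u v where x: "x = (d, u, v)" by (cases x)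
  show P
  proof (cases u rule: rev_cases)
    case Nil
    then show P using 2 x by simp
  next
    case u: (snoc u' a)
    show P
    proof (cases v rule: rev_cases)
      case Nil
      then show P using 1 x by simp
    next
      case (snoc v' b)
      then show P using 3 x u by simp
    qed
  qed
qed simp_all
termination by (relation "measure (\<lambda>(d, u, v). length u + length v)") simp_all

definition qshuffle ::
  "nat \<Rightarrow> (letter list \<Rightarrow>\<^sub>0 real) \<Rightarrow> (letter list \<Rightarrow>\<^sub>0 real) \<Rightarrow> (letter list \<Rightarrow>\<^sub>0 real)" where
  "qshuffle d = bilinear_ext (word_qshuffle d)"

datatype 'a bar = Bar 'a

definition bar_word :: "'a list \<Rightarrow> ('a bar list \<Rightarrow>\<^sub>0 real)" where
  "bar_word w = word_vec (map Bar w)"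

definition bar_letter0 :: "nat \<Rightarrow> nat \<Rightarrow> letter \<Rightarrow> (letter bar list \<Rightarrow>\<^sub>0 real)" where
  "bar_letter0 d l a =
     (\<Sum>as | as \<in> words d l \<and> as \<noteq> [] \<and> iter_bracket d as = Poly_Mapping.single a 1.
        ((-1) ^ (length as - 1) / real (length as)) *\<^sub>R bar_word as)"

definition bar_word0 :: "nat \<Rightarrow> nat \<Rightarrow> letter list \<Rightarrow> (letter bar list \<Rightarrow>\<^sub>0 real)" where
  "bar_word0 d l w = prod_list (map (bar_letter0 d l) w)"

definition pairing :: "('a list \<Rightarrow>\<^sub>0 real) \<Rightarrow> ('a bar list \<Rightarrow>\<^sub>0 real) \<Rightarrow> real" where
  "pairing = bilinear_ext (\<lambda>w w'. if w' = map Bar w then 1 else 0)"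

text \<open>
  The element of the dual basis belonging to \<open>bar_word0 d l w\<close>. It exists and is unique because
  the vectors \<open>bar_word0 d l v\<close> form a basis, each homogeneous for the total level, and there are only
  finitely many words of a given total level.
\<close>

definition dual_word0 :: "nat \<Rightarrow> nat \<Rightarrow> letter list \<Rightarrow> (letter list \<Rightarrow>\<^sub>0 real)" where
  "dual_word0 d l w = (THE x. x \<in> word_space d l \<and>
     (\<forall>v\<in>words d l. pairing x (bar_word0 d l v) = (if v = w then 1 else 0)))"

definition tensor ::
  "('a list \<Rightarrow>\<^sub>0 real) \<Rightarrow> ('a bar list \<Rightarrow>\<^sub>0 real) \<Rightarrow> ('a list \<Rightarrow>\<^sub>0 real) \<Rightarrow> ('a list \<Rightarrow>\<^sub>0 real)" where
  "tensor x y = (\<lambda>z. pairing z y *\<^sub>R x)"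

text \<open>
  A possibly infinite family \<open>T\<close> of endomorphisms of \<open>V\<close> has the formal sum \<open>F\<close> if on each
  vector only finitely many members are nonzero and these add up to \<open>F\<close>.
\<close>

definition has_formal_sum ::
  "'v::comm_monoid_add set \<Rightarrow> ('i \<Rightarrow> 'v \<Rightarrow> 'v) \<Rightarrow> 'i set \<Rightarrow> ('v \<Rightarrow> 'v) \<Rightarrow> bool" where
  "has_formal_sum V T I F \<longleftrightarrow>
     (\<forall>z\<in>V. finite {i \<in> I. T i z \<noteq> 0} \<and> (\<Sum>i | i \<in> I \<and> T i z \<noteq> 0. T i z) = F z)"

definition Sh :: "nat \<Rightarrow> nat \<Rightarrow> (nat \<Rightarrow> nat) set" where
  "Sh n m = {\<sigma>. \<sigma> permutes {1..n + m}
     \<and> strict_mono_on {1..n} (inv \<sigma>) \<and> strict_mono_on {n + 1..n + m} (inv \<sigma>)}"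

text \<open>
  \<open>finite_iter_bracket_eq\<close> below ensures that the sum in \<open>bar_letter0\<close> is over a finite set, so that it
  is not 0 by convention.
\<close>

lemma letter_bracket_cases:
  "letter_bracket d a b = 0
   \<or> letter_bracket d a b = Poly_Mapping.single (Letter (index a) (level a + level b)) 1"
  by (cases a; cases b) simp

lemma bracket_single:
  "bracket d (Poly_Mapping.single a 1) (Poly_Mapping.single b 1) = letter_bracket d a b"
  by (simp add: bracket_def bilinear_ext_def)

lemma iter_bracket_cases:
  assumes "w \<noteq> []"
  shows "iter_bracket d w = 0
    \<or> (\<exists>i. iter_bracket d w = Poly_Mapping.single (Letter i (sum_list (map level w))) 1)"
  using assms
proof (induction d w rule: iter_bracket.induct)
  case (2 d a)
  then show ?case by (cases a) auto
next
  case (3 d a b w)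
  then consider "iter_bracket d (b # w) = 0"
    | i where "iter_bracket d (b # w)
        = Poly_Mapping.single (Letter i (sum_list (map level (b # w)))) 1"
    by auto
  then show ?case
  proof cases
    case 1
    then show ?thesis by (simp add: bracket_def bilinear_ext_def)
  next
    case 2
    then show ?thesis
      using letter_bracket_cases[of d a "Letter i (sum_list (map level (b # w)))"]
      by (auto simp: bracket_single simp del: letter_bracket.simps)
  qed
qed simp

lemma finite_iter_bracket_eq:
  "finite {as \<in> words d l. as \<noteq> [] \<and> iter_bracket d as = Poly_Mapping.single a 1}"
proof -
  let ?A = "(\<lambda>(i, m). Letter i m) ` ({..d + l} \<times> {..level a})"
  have "set as \<subseteq> ?A \<and> length as \<le> level a"
    if as: "as \<in> words d l" "as \<noteq> []" "iter_bracket d as = Poly_Mapping.single a 1" for as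
  proof -
    have alph: "set as \<subseteq> alphabet d l" using as(1) by (auto simp: words_def)
    have "Poly_Mapping.lookup (Poly_Mapping.single a (1::real)) a \<noteq> 0" by simp
    then have "Poly_Mapping.single a (1::real) \<noteq> 0" by (metis lookup_zero)
    with iter_bracket_cases[OF as(2), of d] as(3)
    obtain i where "Poly_Mapping.single a (1::real)
        = Poly_Mapping.single (Letter i (sum_list (map level as))) 1" by auto
    then have "Poly_Mapping.keys (Poly_Mapping.single a (1::real))
        = Poly_Mapping.keys (Poly_Mapping.single (Letter i (sum_list (map level as))) (1::real))"
      by (rule arg_cong)
    then have "a = Letter i (sum_list (map level as))" by simp
    then have lev: "level a = sum_list (map level as)" by simp
    have "\<forall>b\<in>set as. 1 \<le> level b" "\<forall>b\<in>set as. index b \<le> d + l"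
      using alph by (auto simp: alphabet_def)
    moreover have "\<forall>b\<in>set as. level b \<le> level a"
      unfolding lev by (simp add: member_le_sum_list)
    moreover have "length as \<le> sum_list (map level as)"
      using sum_list_mono[of as "\<lambda>_. 1" level] calculation(1)
      by (simp add: sum_list_triv)
    moreover have "b \<in> ?A" if "index b \<le> d + l" "level b \<le> level a" for b
      using that by (cases b) force
    ultimately show ?thesis using lev by auto
  qed
  then have "{as \<in> words d l. as \<noteq> [] \<and> iter_bracket d as = Poly_Mapping.single a 1}
      \<subseteq> {as. set as \<subseteq> ?A \<and> length as \<le> level a}" by blast
  then show ?thesis
    by (rule finite_subset) (intro finite_lists_length_le, simp)
qed

end

theory Submission
  imports Defs "HOL-Computational_Algebra.Polynomial"
begin

text \<open>
  Each $\overline a^0$ is the component at $\overline a$ of a logarithm, and this makes it primitive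
  for the coproduct dual to $\star$. Products of primitive elements have the unshuffling coproduct,
  so in the dual basis $\star$ becomes the shuffle product. The proof below carries out this
  argument on words, without a coproduct.

  Write $K_c(w) = \langle w, \overline c^0\rangle$. Primitivity of $\overline c^0$ says that $K_c$
  vanishes on \<open>u \<star> v\<close> for nonempty words $u$ and $v$ (\<open>bar_coeff_word_qshuffle\<close>). To see this, note
  that a nonempty word has bracket $c$ exactly if all its letters have the index of $c$ and their levels
  add up to the level of $c$ (\<open>iter_bracket_eq_single_iff\<close>). This condition takes the same truth
  value on all words of \<open>u \<star> v\<close>. If it holds, then no bracket of a letter of $u$ with one of $v$
  vanishes, only the lengths of the words of \<open>u \<star> v\<close> matter, and
  the claim is $\sum_w (-1)^{|w|-1}/|w| = 0$, the sum running over these words with their multiplicities.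
  Now $(-1)^{k-1}/k$ is the coefficient of $x$ in the polynomial $\binom xk$, and
  $\sum_w \binom x{|w|} = \binom x{|u|}\binom x{|v|}$ (\<open>qshuffle_binomial_poly\<close>), which has no linear term
  since both factors vanish at 0.

  The transpose of left multiplication by $\overline c^0$ is the operator $T_c$ that removes a prefix
  $p$ from a word with weight $K_c(p)$ (\<open>bar_contract\<close>). The vanishing of $K_c$ on nontrivial products makes $T_c$ a
  derivation of $\star$ (\<open>left_contract_derivation\<close>). On the dual basis, $T_c$ deletes the
  first letter of $w^0$ if that is $c$ and gives 0 otherwise. The operators $T_c$ together with the coefficient of the empty
  word determine an element (\<open>eq_if_bar_contract_eq\<close>), and both sides of the
  shuffle formula have the same images under every $T_c$ by induction (\<open>qshuffle_dual_word0\<close>).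

  The dual basis exists because $\overline w^0$ is $\overline w$ plus longer words
  (\<open>bar_pairing_triangular\<close>) while only finitely many $\overline v^0$ pair nontrivially with a given
  word. The second formula for the identity is then an expansion in this basis.
\<close>

section \<open>Linear maps on the free algebra\<close>

lemma lookup_scaleR [simp]:
  fixes x :: "'a \<Rightarrow>\<^sub>0 'b::real_vector"
  shows "Poly_Mapping.lookup (c *\<^sub>R x) k = c *\<^sub>R Poly_Mapping.lookup x k"
proof -
  have "finite {i. c *\<^sub>R Poly_Mapping.lookup x i \<noteq> 0}"
    by (rule finite_subset[OF _ finite_lookup[of x]]) auto
  then show ?thesis by (simp add: scaleR_poly_mapping_def)
qed

lemma keys_scaleR: "Poly_Mapping.keys (c *\<^sub>R x :: 'a \<Rightarrow>\<^sub>0 real) \<subseteq> Poly_Mapping.keys x"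
  by (auto simp: in_keys_iff)

lemma lookup_word_vec: "Poly_Mapping.lookup (word_vec v) w = (if w = v then 1 else 0)"
  by (simp add: word_vec_def lookup_single when_def)

lemma keys_word_vec [simp]: "Poly_Mapping.keys (word_vec w) = {w}"
  by (simp add: word_vec_def)

lemma sum_lookup_single: "(\<Sum>w\<in>Poly_Mapping.keys x. Poly_Mapping.single w (Poly_Mapping.lookup x w)) = x"
  by (rule poly_mapping_eqI)
    (simp add: lookup_sum lookup_single when_def in_keys_iff)

definition linear_ext :: "('a \<Rightarrow> 'c::real_vector) \<Rightarrow> ('a \<Rightarrow>\<^sub>0 real) \<Rightarrow> 'c" where
  "linear_ext F x = (\<Sum>w\<in>Poly_Mapping.keys x. Poly_Mapping.lookup x w *\<^sub>R F w)"

lemma linear_ext_superset: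
  assumes "finite A" "Poly_Mapping.keys x \<subseteq> A"
  shows "linear_ext F x = (\<Sum>w\<in>A. Poly_Mapping.lookup x w *\<^sub>R F w)"
  unfolding linear_ext_def using assms by (intro sum.mono_neutral_left) (auto simp: in_keys_iff)

lemma linear_linear_ext: "linear (linear_ext F)"
proof
  fix x y :: "'a \<Rightarrow>\<^sub>0 real" and c :: real
  let ?A = "Poly_Mapping.keys x \<union> Poly_Mapping.keys y"
  have "Poly_Mapping.keys (x + y) \<subseteq> ?A" by (rule keys_add)
  then show "linear_ext F (x + y) = linear_ext F x + linear_ext F y"
    by (simp add: linear_ext_superset[where A = ?A] lookup_add scaleR_add_left sum.distrib)
  show "linear_ext F (c *\<^sub>R x) = c *\<^sub>R linear_ext F x"
    by (simp add: linear_ext_superset[where A = "Poly_Mapping.keys x"] keys_scaleR scaleR_sum_right)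
qed

lemmas linear_ext_add = linear_add[OF linear_linear_ext]
  and linear_ext_0 [simp] = linear_0[OF linear_linear_ext]

lemma linear_ext_word_vec [simp]: "linear_ext F (word_vec w) = F w"
  by (simp add: linear_ext_def lookup_word_vec)

lemma word_expansion: "linear_ext word_vec x = x"
  by (rule poly_mapping_eqI)
     (simp add: linear_ext_def lookup_sum lookup_word_vec in_keys_iff if_distrib cong: if_cong)

text \<open>
  A linear map is determined by its values on words; this reduces most of the identities below to words.
\<close>

lemma linear_eq_linear_ext:
  assumes "linear f" shows "f x = linear_ext (\<lambda>w. f (word_vec w)) x"
proof -
  have "f x = f (linear_ext word_vec x)" by (simp add: word_expansion)
  also have "\<dots> = linear_ext (\<lambda>w. f (word_vec w)) x"
    unfolding linear_ext_def by (simp add: linear_sum[OF assms] linear_scale[OF assms])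
  finally show ?thesis .
qed

lemma linear_eq_on_words:
  assumes "linear f" "linear g" "Poly_Mapping.keys x \<subseteq> W"
    and "\<And>w. w \<in> W \<Longrightarrow> f (word_vec w) = g (word_vec w)"
  shows "f x = g x"
proof -
  have "linear_ext (\<lambda>w. f (word_vec w)) x = linear_ext (\<lambda>w. g (word_vec w)) x"
    unfolding linear_ext_def using assms(3,4) by (intro sum.cong) auto
  then show ?thesis using linear_eq_linear_ext[OF assms(1)] linear_eq_linear_ext[OF assms(2)] by metis
qed

lemma linear_linear_ext_param:
  assumes "\<And>w. linear (\<lambda>y. F y w)"
  shows "linear (\<lambda>y. linear_ext (F y) x)"
  unfolding linear_ext_def
  by (intro linear_compose_sum ballI linear_compose_scale_right assms)

lemma bilinear_ext_eq: "bilinear_ext B x y = linear_ext (\<lambda>a. linear_ext (B a) y) x"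
  by (simp add: bilinear_ext_def linear_ext_def scaleR_sum_right)

text \<open>
  The convolution product of the free algebra, evaluated by deconcatenation: the two factors of a word
  are a prefix and the corresponding suffix.
\<close>

lemma lookup_times_list:
  fixes p q :: "'a list \<Rightarrow>\<^sub>0 real"
  shows "Poly_Mapping.lookup (p * q) w
    = (\<Sum>i\<le>length w. Poly_Mapping.lookup p (take i w) * Poly_Mapping.lookup q (drop i w))"
proof -
  let ?p = "Poly_Mapping.lookup p" and ?q = "Poly_Mapping.lookup q"
  have split: "(\<Sum>i\<le>length w. if u = take i w \<and> v = drop i w then c else 0)
      = (if u @ v = w then c else 0)" for u v and c :: real
  proof (cases "u @ v = w")
    case True
    then have "(\<Sum>i\<le>length w. if u = take i w \<and> v = drop i w then c else 0)
        = (\<Sum>i\<le>length w. if i = length u then c else 0)"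
      by (intro sum.cong) auto
    also have "\<dots> = c" using True by auto
    finally show ?thesis using True by simp
  qed (auto intro!: sum.neutral)
  have at: "Poly_Mapping.lookup r k = (\<Sum>u\<in>Poly_Mapping.keys r. if u = k then Poly_Mapping.lookup r u else 0)"
    for r :: "'a list \<Rightarrow>\<^sub>0 real" and k
    by (simp add: in_keys_iff)
  have "p * q = (\<Sum>u\<in>Poly_Mapping.keys p. Poly_Mapping.single u (?p u))
      * (\<Sum>v\<in>Poly_Mapping.keys q. Poly_Mapping.single v (?q v))"
    by (simp add: sum_lookup_single)
  also have "Poly_Mapping.lookup \<dots> w = (\<Sum>u\<in>Poly_Mapping.keys p. \<Sum>v\<in>Poly_Mapping.keys q.
      if u @ v = w then ?p u * ?q v else 0)"
    by (simp add: sum_product mult_single lookup_sum lookup_single when_def plus_list_def)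
  also have "\<dots> = (\<Sum>u\<in>Poly_Mapping.keys p. \<Sum>v\<in>Poly_Mapping.keys q. \<Sum>i\<le>length w.
      if u = take i w \<and> v = drop i w then ?p u * ?q v else 0)"
    by (simp only: split)
  also have "\<dots> = (\<Sum>u\<in>Poly_Mapping.keys p. \<Sum>i\<le>length w. \<Sum>v\<in>Poly_Mapping.keys q.
      if u = take i w \<and> v = drop i w then ?p u * ?q v else 0)"
    by (intro sum.cong refl sum.swap)
  also have "\<dots> = (\<Sum>i\<le>length w. \<Sum>u\<in>Poly_Mapping.keys p. \<Sum>v\<in>Poly_Mapping.keys q.
      if u = take i w \<and> v = drop i w then ?p u * ?q v else 0)"
    by (rule sum.swap)
  also have "\<dots> = (\<Sum>i\<le>length w. ?p (take i w) * ?q (drop i w))"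
    by (intro sum.cong refl, subst (3) at, subst (3) at, unfold sum_product, intro sum.cong refl) auto
  finally show ?thesis .
qed

lemma word_vec_mult: "word_vec u * word_vec v = word_vec (u @ v)"
  by (simp add: word_vec_def mult_single plus_list_def)

lemma word_vec_Nil: "word_vec [] = 1"
  by (metis word_vec_def zero_list_def single_one)

lemma linear_times_right: "linear (\<lambda>x. x * (q :: 'a list \<Rightarrow>\<^sub>0 real))"
proof
  show "(x + y) * q = x * q + y * q" for x y by (rule distrib_right)
  show "(c *\<^sub>R x) * q = c *\<^sub>R (x * q)" for c x
    by (rule poly_mapping_eqI) (simp add: lookup_times_list sum_distrib_left mult.assoc)
qed

section \<open>The quasi-shuffle product as a bilinear map\<close>

lemma letter_bracket_eq:
  "letter_bracket d a b =
     (if index a = index b \<and> (1 \<le> index a \<and> index a \<le> d \<and> level a = 1 \<and> level b = 1 \<or> d + 1 \<le> index a)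
      then Poly_Mapping.single (Letter (index a) (level a + level b)) 1 else 0)"
  by (cases a; cases b) auto

lemma single_1_eq_iff [simp]:
  "Poly_Mapping.single a (1::real) = Poly_Mapping.single b 1 \<longleftrightarrow> a = b"
  by (metis lookup_single_eq lookup_single_not_eq zero_neq_one)

lemma single_1_neq_0 [simp]: "Poly_Mapping.single a (1::real) \<noteq> 0"
  by (metis lookup_single_eq lookup_zero zero_neq_one)

lemma letters_to_words_single: "letters_to_words (Poly_Mapping.single a 1) = word_vec [a]"
  by (simp add: letters_to_words_def)

lemma letters_to_words_0: "letters_to_words 0 = 0"
  by (simp add: letters_to_words_def)

lemma word_qshuffle_Nil_left [simp]: "word_qshuffle d [] v = word_vec v"
  by (cases v rule: rev_cases) simp_all

lemma qshuffle_eq: "qshuffle d x y = linear_ext (\<lambda>u. linear_ext (word_qshuffle d u) y) x"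
  by (simp add: qshuffle_def bilinear_ext_eq)

lemma linear_qshuffle_left: "linear (\<lambda>x. qshuffle d x y)"
  unfolding qshuffle_eq by (rule linear_linear_ext)

lemma linear_qshuffle_right: "linear (\<lambda>y. qshuffle d x y)"
  unfolding qshuffle_eq by (rule linear_linear_ext_param, rule linear_linear_ext)

lemmas qshuffle_linear_simps =
  linear_add[OF linear_qshuffle_left] linear_add[OF linear_qshuffle_right]
  linear_scale[OF linear_qshuffle_left] linear_scale[OF linear_qshuffle_right]
  linear_0[OF linear_qshuffle_left] linear_0[OF linear_qshuffle_right]

lemma qshuffle_word_vec: "qshuffle d (word_vec u) (word_vec v) = word_qshuffle d u v"
  by (simp add: qshuffle_eq)

lemma qshuffle_1_right [simp]: "qshuffle d x 1 = x"
  by (simp add: qshuffle_eq word_expansion flip: word_vec_Nil)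

lemma qshuffle_1_left [simp]: "qshuffle d 1 y = y"
proof -
  have "word_qshuffle d [] = word_vec" by (rule ext) simp
  then show ?thesis by (simp add: qshuffle_eq word_expansion flip: word_vec_Nil)
qed

lemma linear_comp: "linear f \<Longrightarrow> linear g \<Longrightarrow> linear (\<lambda>x. f (g x))"
  using linear_compose[of g f] by (simp add: o_def)

text \<open>
  The recursion for $\star$ survives when the words $u$ and $v$ are replaced by arbitrary elements; in this
  form it can be applied to the result of a contraction.
\<close>

lemma qshuffle_snoc_snoc:
  "qshuffle d (x * word_vec [a]) (y * word_vec [b]) =
     qshuffle d x (y * word_vec [b]) * word_vec [a] + qshuffle d (x * word_vec [a]) y * word_vec [b]
     + qshuffle d x y * letters_to_words (letter_bracket d a b)"
    (is "?L x y = ?R x y")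
proof (rule linear_eq_on_words[where W = UNIV and x = x])
  show "linear (\<lambda>x. ?L x y)" "linear (\<lambda>x. ?R x y)"
    by (intro linear_compose_add linear_comp[OF linear_times_right]
        linear_comp[OF linear_qshuffle_left] linear_qshuffle_left linear_times_right)+
next
  fix u
  show "?L (word_vec u) y = ?R (word_vec u) y"
  proof (rule linear_eq_on_words[where W = UNIV and x = y])
    show "linear (?L (word_vec u))" "linear (?R (word_vec u))"
      by (intro linear_compose_add linear_comp[OF linear_times_right]
          linear_comp[OF linear_qshuffle_right] linear_qshuffle_right linear_times_right)+
    show "?L (word_vec u) (word_vec v) = ?R (word_vec u) (word_vec v)" for v
      by (simp add: word_vec_mult qshuffle_word_vec)
  qed simp
qed simp

lemma linear_ext_times_letter:
  "linear_ext F (x * word_vec [a]) = linear_ext (\<lambda>w. F (w @ [a])) x"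
  by (rule linear_eq_on_words[where W = UNIV])
     (auto intro!: linear_comp[OF linear_linear_ext] linear_times_right linear_linear_ext simp: word_vec_mult)

section \<open>Contraction as a derivation\<close>

text \<open>
  The transpose of left multiplication by an element $\overline y$, where \<open>F w\<close> is $\langle w, \overline y\rangle$.
  Contracting on the left fits the quasi-shuffle recursion, which appends letters on the right.
\<close>

definition left_contract :: "('a list \<Rightarrow> real) \<Rightarrow> ('a list \<Rightarrow>\<^sub>0 real) \<Rightarrow> ('a list \<Rightarrow>\<^sub>0 real)" where
  "left_contract F = linear_ext (\<lambda>w. \<Sum>i\<le>length w. F (take i w) *\<^sub>R word_vec (drop i w))"

lemma linear_left_contract: "linear (left_contract F)"
  unfolding left_contract_def by (rule linear_linear_ext)

lemma left_contract_word_vec: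
  "left_contract F (word_vec w) = (\<Sum>i\<le>length w. F (take i w) *\<^sub>R word_vec (drop i w))"
  by (simp add: left_contract_def)

lemma left_contract_1 [simp]: "left_contract F 1 = F [] *\<^sub>R 1"
  using left_contract_word_vec[of F "[]"] by (simp add: word_vec_Nil)

lemma scaleR_times_left: "c *\<^sub>R x * (q :: 'a list \<Rightarrow>\<^sub>0 real) = c *\<^sub>R (x * q)"
  using linear_scale[OF linear_times_right[of q]] .

text \<open>
  A prefix of a word ending in $a$ is either a prefix of the word without this $a$ or the whole word;
  the scalar term comes from the latter.
\<close>

lemma left_contract_times_letter:
  "left_contract F (x * word_vec [a]) =
     left_contract F x * word_vec [a] + linear_ext F (x * word_vec [a]) *\<^sub>R 1"
proof (rule linear_eq_on_words[where W = UNIV and x = x])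
  show "linear (\<lambda>x. left_contract F (x * word_vec [a]))"
    by (intro linear_comp[OF linear_left_contract] linear_times_right)
  show "linear (\<lambda>x. left_contract F x * word_vec [a] + linear_ext F (x * word_vec [a]) *\<^sub>R 1)"
    by (intro linear_compose_add linear_comp[OF linear_times_right] linear_left_contract
        linear_comp[OF linear_scale_left] linear_comp[OF linear_linear_ext] linear_times_right)
  show "left_contract F (word_vec w * word_vec [a]) =
     left_contract F (word_vec w) * word_vec [a] + linear_ext F (word_vec w * word_vec [a]) *\<^sub>R 1" for w
    by (simp add: word_vec_mult left_contract_word_vec sum_distrib_right scaleR_times_left word_vec_Nil)
qed simp

lemma snoc_snoc_induct [case_names Nil_right Nil_left snoc_snoc]:
  assumes "\<And>u. P u []" "\<And>v. P [] v"
    and "\<And>u a v b. P u (v @ [b]) \<Longrightarrow> P (u @ [a]) v \<Longrightarrow> P u v \<Longrightarrow> P (u @ [a]) (v @ [b])"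
  shows "P u v"
proof (induction u arbitrary: v rule: rev_induct)
  case (snoc a u)
  then show ?case by (induction v rule: rev_induct) (auto intro: assms)
qed (rule assms)

text \<open>
  If \<open>F\<close> kills the empty word and all products of nonempty words, it is an infinitesimal character
  of $\star$, and contraction with it is a derivation. In the step of the induction, three products are contracted; each
  leaves a scalar term for the prefix that is the whole word, and the three scalars add up to
  \<open>F\<close> of the product $ua \star vb$, which is 0.
\<close>

lemma left_contract_derivation:
  assumes closed: "\<And>u a. u @ [a] \<in> W \<Longrightarrow> u \<in> W"
    and F_Nil: "F [] = 0"
    and F_prod: "\<And>u v. u \<in> W \<Longrightarrow> v \<in> W \<Longrightarrow> u \<noteq> [] \<Longrightarrow> v \<noteq> [] \<Longrightarrow> linear_ext F (word_qshuffle d u v) = 0"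
  shows "u \<in> W \<Longrightarrow> v \<in> W \<Longrightarrow> left_contract F (word_qshuffle d u v) =
    qshuffle d (left_contract F (word_vec u)) (word_vec v)
    + qshuffle d (word_vec u) (left_contract F (word_vec v))"
proof (induction u v rule: snoc_snoc_induct)
  case (Nil_right u)
  then show ?case by (simp add: word_vec_Nil F_Nil qshuffle_linear_simps)
next
  case (Nil_left v)
  then show ?case by (simp add: word_vec_Nil F_Nil qshuffle_linear_simps)
next
  case (snoc_snoc u a v b)
  let ?C = "left_contract F" and ?A = "word_vec [a]" and ?B = "word_vec [b]"
  let ?N = "letters_to_words (letter_bracket d a b)"
  define x y where "x = word_vec u" and "y = word_vec v"
  have xA: "word_vec (u @ [a]) = x * ?A" and yB: "word_vec (v @ [b]) = y * ?B"
    by (simp_all add: x_def y_def word_vec_mult)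
  have W: "u \<in> W" "v \<in> W" using snoc_snoc closed by blast+
  define X Y Z where "X = qshuffle d x (y * ?B)" and "Y = qshuffle d (x * ?A) y" and "Z = qshuffle d x y"
  have whole: "word_qshuffle d (u @ [a]) (v @ [b]) = X * ?A + Y * ?B + Z * ?N"
    by (simp add: X_def Y_def Z_def x_def y_def word_vec_mult qshuffle_word_vec)
  have IH: "?C X = qshuffle d (?C x) (y * ?B) + qshuffle d x (?C (y * ?B))"
    "?C Y = qshuffle d (?C (x * ?A)) y + qshuffle d (x * ?A) (?C y)"
    "?C Z = qshuffle d (?C x) y + qshuffle d x (?C y)"
    using snoc_snoc W by (simp_all add: X_def Y_def Z_def x_def y_def word_vec_mult qshuffle_word_vec)
  have N: "?C (Z * ?N) = ?C Z * ?N + linear_ext F (Z * ?N) *\<^sub>R 1"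
    using left_contract_times_letter[of F Z]
    by (simp add: letter_bracket_eq letters_to_words_single letters_to_words_0
        linear_0[OF linear_left_contract])
  \<comment> \<open>The scalar terms left by the three products cancel.\<close>
  have "linear_ext F (X * ?A + Y * ?B + Z * ?N) = 0"
    unfolding whole[symmetric] by (rule F_prod) (use snoc_snoc in auto)
  then have zero: "linear_ext F (X * ?A) + linear_ext F (Y * ?B) + linear_ext F (Z * ?N) = 0"
    by (simp add: linear_ext_add)
  have "?C (X * ?A + Y * ?B + Z * ?N) = ?C X * ?A + ?C Y * ?B + ?C Z * ?N
      + (linear_ext F (X * ?A) + linear_ext F (Y * ?B) + linear_ext F (Z * ?N)) *\<^sub>R 1"
    by (simp add: linear_add[OF linear_left_contract] N left_contract_times_letter scaleR_add_left)
  also have "\<dots> = ?C X * ?A + ?C Y * ?B + ?C Z * ?N"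
    by (simp add: zero)
  also have "\<dots> = qshuffle d (?C (x * ?A)) (y * ?B) + qshuffle d (x * ?A) (?C (y * ?B))"
    by (simp add: IH left_contract_times_letter qshuffle_linear_simps qshuffle_snoc_snoc
        distrib_right scaleR_times_left)
  finally show ?case by (simp only: whole xA yB)
qed

section \<open>Binomial characters\<close>

lemma linear_ext_zero: "linear_ext (\<lambda>w. 0) x = 0"
  by (simp add: linear_ext_def)

text \<open>
  As long as no bracket vanishes, $w \mapsto \binom x{|w|}$ is a character of $\star$. By Pascal's rule, raising $x$ by one
  adds the term in which the last letter is deleted, and the three kinds of last letter in the recursion for
  $ua \star vb$ account for the three extra terms of the product
  $\left(\binom x{p+1} + \binom xp\right)\left(\binom x{q+1} + \binom xq\right)$.
\<close>

lemma linear_ext_choose_qshuffle: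
  assumes "\<And>a b. a \<in> set u \<Longrightarrow> b \<in> set v \<Longrightarrow> letter_bracket d a b \<noteq> 0"
  shows "linear_ext (\<lambda>w. real (x choose length w)) (word_qshuffle d u v)
    = real (x choose length u) * real (x choose length v)"
  using assms
proof (induction x arbitrary: u v)
  case 0
  show ?case
  proof (cases u rule: rev_cases)
    case Nil
    then show ?thesis by simp
  next
    case u: (snoc u' a)
    show ?thesis
    proof (cases v rule: rev_cases)
      case Nil
      then show ?thesis by simp
    next
      case v: (snoc v' b)
      have "letter_bracket d a b \<noteq> 0" using 0 u v by simp
      then show ?thesis unfolding u v
        by (auto simp: letter_bracket_eq letters_to_words_single linear_ext_add linear_ext_times_letter
            linear_ext_zero split: if_splits)
    qed
  qed
next
  case (Suc x)
  show ?case
  proof (cases u rule: rev_cases)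
    case Nil
    then show ?thesis by simp
  next
    case u: (snoc u' a)
    show ?thesis
    proof (cases v rule: rev_cases)
      case Nil
      then show ?thesis by simp
    next
      case v: (snoc v' b)
      let ?C = "\<lambda>w. real (x choose length w)"
      have "letter_bracket d a b \<noteq> 0" using Suc.prems u v by simp
      then obtain e where e: "letters_to_words (letter_bracket d a b) = word_vec [e]"
        by (auto simp: letter_bracket_eq letters_to_words_single split: if_splits)
      have pascal: "linear_ext (\<lambda>w. real (Suc x choose length w)) (X * word_vec [c])
          = linear_ext ?C (X * word_vec [c]) + linear_ext ?C X" for X :: "letter list \<Rightarrow>\<^sub>0 real" and c
        by (simp add: linear_ext_times_letter)
           (simp add: linear_ext_def algebra_simps sum.distrib)
      have IH: "linear_ext ?C (word_qshuffle d u'' v'') = ?C u'' * ?C v''"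
        if "set u'' \<subseteq> set u" "set v'' \<subseteq> set v" for u'' v''
        by (rule Suc.IH) (use that Suc.prems in blast)
      have "linear_ext (\<lambda>w. real (Suc x choose length w)) (word_qshuffle d u v)
        = linear_ext ?C (word_qshuffle d u v) + linear_ext ?C (word_qshuffle d u' v)
          + linear_ext ?C (word_qshuffle d u v') + linear_ext ?C (word_qshuffle d u' v')"
        unfolding u v by (simp only: word_qshuffle.simps e linear_ext_add pascal)
      also have "\<dots> = ?C u * ?C v + ?C u' * ?C v + ?C u * ?C v' + ?C u' * ?C v'"
        by (subst (1 2 3 4) IH) (auto simp: u v)
      also have "\<dots> = real (Suc x choose length u) * real (Suc x choose length v)"
        by (simp add: u v algebra_simps)
      finally show ?thesis .
    qed
  qed
qed

definition binomial_poly :: "nat \<Rightarrow> real poly" where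
  "binomial_poly k = smult (1 / fact k) (\<Prod>i<k. [:- real i, 1:])"

lemma poly_binomial_poly: "poly (binomial_poly k) (real x) = real (x choose k)"
  by (simp add: binomial_poly_def poly_prod binomial_gbinomial gbinomial_prod_rev atLeast0LessThan)

lemma coeff_binomial_poly_0: "k > 0 \<Longrightarrow> coeff (binomial_poly k) 0 = 0"
  by (auto simp add: binomial_poly_def poly_prod simp flip: poly_0_coeff_0)

text \<open>
  These are the coefficients of the logarithm series: $(1+t)^x = \sum_k \binom xk t^k$ has derivative $\ln(1+t)$
  with respect to $x$ at $x = 0$.
\<close>

lemma coeff_binomial_poly_1:
  assumes "k > 0" shows "coeff (binomial_poly k) 1 = (-1) ^ (k - 1) / real k"
proof -
  have rec: "smult (real k + 1) (binomial_poly (Suc k)) = binomial_poly k * [:- real k, 1:]" for k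
  proof -
    have "(real k + 1) * (1 / fact (Suc k)) = 1 / fact k"
      by (simp add: divide_simps)
    then show ?thesis
      by (simp only: binomial_poly_def smult_smult mult_smult_left prod.lessThan_Suc)
  qed
  have "coeff (binomial_poly (Suc k)) 1 = (-1) ^ k / real (Suc k)" for k
  proof (induction k)
    case 0
    then show ?case by (simp add: binomial_poly_def)
  next
    case (Suc k)
    have "real (Suc (Suc k)) * coeff (binomial_poly (Suc (Suc k))) 1
       = coeff (binomial_poly (Suc k) * [:- real (Suc k), 1:]) 1"
      unfolding rec[of "Suc k", symmetric] by (simp add: add_ac)
    also have "\<dots> = - real (Suc k) * coeff (binomial_poly (Suc k)) 1"
      using coeff_binomial_poly_0[of "Suc k"] by simp
    finally show ?case unfolding Suc by (simp add: field_simps del: of_nat_Suc)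
  qed
  from this[of "k - 1"] assms show ?thesis by simp
qed

section \<open>Brackets determined by index and level\<close>

lemma alphabet_iff:
  "a \<in> alphabet d l \<longleftrightarrow> index a \<le> l \<and> 1 \<le> level a \<and>
     (level a = 1 \<or> 1 \<le> index a \<and> index a \<le> d \<and> level a = 2 \<or> d < index a)"
  if "d \<le> l"
  using that by (cases a) (auto simp: alphabet_def)

definition total_level :: "letter list \<Rightarrow> nat" where
  "total_level w = sum_list (map level w)"

lemma total_level_simps [simp]:
  "total_level [] = 0" "total_level (a # w) = level a + total_level w"
  "total_level (v @ w) = total_level v + total_level w"
  by (simp_all add: total_level_def)

lemma keys_times_letter: "w \<in> Poly_Mapping.keys (x * word_vec [a]) \<Longrightarrow> \<exists>v\<in>Poly_Mapping.keys x. w = v @ [a]"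
  using keys_mult[of x "word_vec [a]"] by (auto simp: plus_list_def)

lemma letter_bracket_alphabet:
  assumes "d \<le> l" "a \<in> alphabet d l" "b \<in> alphabet d l"
    and "letter_bracket d a b = Poly_Mapping.single e 1"
  shows "e \<in> alphabet d l"
  using assms by (auto simp: alphabet_iff letter_bracket_eq split: if_splits)

text \<open>
  Bracketing two letters of the same index adds their levels, so the indices and the total level of a word
  are invariants of the quasi-shuffle.
\<close>

lemma keys_word_qshuffle:
  assumes dl: "d \<le> l"
  shows "u \<in> words d l \<Longrightarrow> v \<in> words d l \<Longrightarrow> w \<in> Poly_Mapping.keys (word_qshuffle d u v) \<Longrightarrow>
    w \<in> words d l \<and> index ` set w = index ` set u \<union> index ` set v
      \<and> total_level w = total_level u + total_level v"
proof (induction u v arbitrary: w rule: snoc_snoc_induct)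
  case (snoc_snoc u a v b)
  let ?N = "letters_to_words (letter_bracket d a b)"
  have W: "u \<in> words d l" "v \<in> words d l" "a \<in> alphabet d l" "b \<in> alphabet d l"
    using snoc_snoc.prems by (auto simp: words_def)
  have "w \<in> Poly_Mapping.keys (word_qshuffle d u (v @ [b]) * word_vec [a])
      \<or> w \<in> Poly_Mapping.keys (word_qshuffle d (u @ [a]) v * word_vec [b])
      \<or> w \<in> Poly_Mapping.keys (word_qshuffle d u v * ?N)"
    using snoc_snoc.prems(3) by (auto dest!: set_mp[OF keys_add])
  then consider
      w' where "w = w' @ [a]" "w' \<in> Poly_Mapping.keys (word_qshuffle d u (v @ [b]))"
    | w' where "w = w' @ [b]" "w' \<in> Poly_Mapping.keys (word_qshuffle d (u @ [a]) v)"
    | w' e where "w = w' @ [e]" "w' \<in> Poly_Mapping.keys (word_qshuffle d u v)"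
        "letter_bracket d a b = Poly_Mapping.single e 1"
  proof (elim disjE)
    assume w: "w \<in> Poly_Mapping.keys (word_qshuffle d u v * ?N)"
    then obtain e where e: "letter_bracket d a b = Poly_Mapping.single e 1"
      by (auto simp: letter_bracket_eq letters_to_words_0 split: if_splits)
    then show thesis using w that(3) by (auto simp: letters_to_words_single dest: keys_times_letter)
  qed (auto dest!: keys_times_letter intro: that)
  then show ?case
  proof cases
    case 1
    then show ?thesis using snoc_snoc.IH(1)[of w'] snoc_snoc.prems W by (auto simp: words_def)
  next
    case 2
    then show ?thesis using snoc_snoc.IH(2)[of w'] snoc_snoc.prems W by (auto simp: words_def)
  next
    case 3
    have "e \<in> alphabet d l" by (rule letter_bracket_alphabet[OF dl W(3,4) 3(3)])
    moreover have "index e = index a \<and> index e = index b \<and> level e = level a + level b"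
      using 3(3) by (auto simp: letter_bracket_eq split: if_splits)
    ultimately show ?thesis using snoc_snoc.IH(3)[of w'] 3 W by (auto simp: words_def)
  qed
qed auto

lemma total_level_ge:
  assumes "d \<le> l" "w \<in> words d l" shows "total_level w \<ge> length w"
  using assms(2) by (induction w) (use assms(1) in \<open>auto simp: words_def alphabet_iff\<close>)

text \<open>
  Whether a bracket vanishes can be read off the letter that it would produce: for equal indices $i$, the bracket of two letters
  is nonzero exactly if the sum of their levels is again a level of a letter with index $i$. As \<open>c\<close> is a letter, this
  sum is never too large.
\<close>

lemma iter_bracket_eq_single_iff:
  assumes dl: "d \<le> l" and "w \<in> words d l" "w \<noteq> []" "c \<in> alphabet d l"
  shows "iter_bracket d w = Poly_Mapping.single c 1 \<longleftrightarrow>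
    index ` set w \<subseteq> {index c} \<and> total_level w = level c"
proof -
  let ?hom = "\<lambda>w c. index ` set w \<subseteq> {index c} \<and> total_level w = level c"
  have "(\<exists>e\<in>alphabet d l. iter_bracket d w = Poly_Mapping.single e 1 \<and> ?hom w e)
      \<or> iter_bracket d w = 0 \<and> (\<forall>c\<in>alphabet d l. \<not> ?hom w c)"
    using assms(2,3)
  proof (induction w)
    case (Cons a w)
    have a: "a \<in> alphabet d l" and w: "w \<in> words d l" using Cons.prems by (auto simp: words_def)
    show ?case
    proof (cases "w = []")
      case True
      then show ?thesis using a by auto
    next
      case False
      then have rec: "iter_bracket d (a # w) = bracket d (Poly_Mapping.single a 1) (iter_bracket d w)"
        by (cases w) auto
      have ge: "total_level w \<ge> 1"
        using total_level_ge[OF dl w] False by (cases w) auto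
      from Cons.IH[OF w False] show ?thesis
      proof (elim disjE conjE bexE)
        fix e assume e: "e \<in> alphabet d l" "iter_bracket d w = Poly_Mapping.single e 1" "index ` set w \<subseteq> {index e}"
          "total_level w = level e"
        have ie: "index ` set w = {index e}"
          using e(3) False by (simp add: subset_singleton_iff)
        let ?f = "Letter (index a) (level a + level e)"
        have "iter_bracket d (a # w) = letter_bracket d a e"
          by (simp add: rec e bracket_single)
        moreover have "?f \<in> alphabet d l \<and> ?hom (a # w) ?f" if "letter_bracket d a e \<noteq> 0"
          using that a e ie by (auto simp: letter_bracket_eq alphabet_iff[OF dl] split: if_splits)
        moreover have "\<not> ?hom (a # w) c" if "letter_bracket d a e = 0" "c \<in> alphabet d l" for c
          using that a e(1,4) ie by (auto simp: letter_bracket_eq alphabet_iff[OF dl] split: if_splits)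
        ultimately show ?thesis
          using letter_bracket_cases[of d a e] by metis
      next
        assume 0: "iter_bracket d w = 0" "\<forall>c\<in>alphabet d l. \<not> ?hom w c"
        have "\<not> ?hom (a # w) c" if "c \<in> alphabet d l" for c
        proof
          assume hom: "?hom (a # w) c"
          \<comment> \<open>A letter with the index of $c$ and a smaller positive level exists in the alphabet, so \<open>w\<close>
            would satisfy the condition for this letter.\<close>
          let ?e = "Letter (index c) (level c - level a)"
          have "?hom w ?e" using hom by auto
          moreover have "?e \<in> alphabet d l"
            using hom that ge a by (auto simp: alphabet_iff[OF dl])
          ultimately show False using 0(2) by blast
        qed
        then show ?thesis using 0(1) by (simp add: rec bracket_def bilinear_ext_def)
      qed
    qed
  qed auto
  then show ?thesis
  proof
    assume "\<exists>e\<in>alphabet d l. iter_bracket d w = Poly_Mapping.single e 1 \<and> ?hom w e"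
    then obtain e where "iter_bracket d w = Poly_Mapping.single e 1" "?hom w e" by blast
    then show ?thesis using assms(3) by (cases e; cases c; cases w) auto
  qed (use assms in \<open>auto simp: eq_commute[of 0]\<close>)
qed

section \<open>Primitivity of the letters $\overline a^0$\<close>

text \<open>
  This is $K_c(w) = \langle w, \overline c^0\rangle$.
\<close>

definition bar_coeff :: "nat \<Rightarrow> nat \<Rightarrow> letter \<Rightarrow> letter list \<Rightarrow> real" where
  "bar_coeff d l c w = Poly_Mapping.lookup (bar_letter0 d l c) (map Bar w)"

lemma inj_map_Bar [simp]: "map Bar u = map Bar v \<longleftrightarrow> u = v"
  by (rule inj_map_eq_map) (simp add: inj_def)

lemma bar_coeff_eq:
  "bar_coeff d l c w =
    (if w \<in> words d l \<and> w \<noteq> [] \<and> iter_bracket d w = Poly_Mapping.single c 1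
     then (-1) ^ (length w - 1) / real (length w) else 0)"
  unfolding bar_coeff_def bar_letter0_def bar_word_def
  by (simp add: lookup_sum lookup_word_vec if_distrib finite_iter_bracket_eq cong: if_cong)

lemma bar_coeff_hom:
  assumes "d \<le> l" "c \<in> alphabet d l" "w \<in> words d l" "w \<noteq> []"
  shows "bar_coeff d l c w =
    (if index ` set w \<subseteq> {index c} \<and> total_level w = level c
     then coeff (binomial_poly (length w)) 1 else 0)"
  using assms by (simp add: bar_coeff_eq iter_bracket_eq_single_iff coeff_binomial_poly_1[simplified])

lemma poly_eqI_of_nat:
  fixes p q :: "real poly"
  assumes "\<And>n. poly p (real n) = poly q (real n)"
  shows "p = q"
proof (rule ccontr)
  assume "p \<noteq> q"
  then have "finite {x. poly (p - q) x = 0}" by (intro poly_roots_finite) simp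
  moreover have "range real \<subseteq> {x. poly (p - q) x = 0}" using assms by auto
  ultimately have "finite (range real)" by (rule rev_finite_subset)
  then show False using finite_imageD[of real UNIV] by (simp add: inj_on_def)
qed

text \<open>
  The character identity holds for all natural numbers $x$, hence for polynomials in $x$.
\<close>

lemma qshuffle_binomial_poly:
  assumes "\<And>a b. a \<in> set u \<Longrightarrow> b \<in> set v \<Longrightarrow> letter_bracket d a b \<noteq> 0"
  shows "(\<Sum>w\<in>Poly_Mapping.keys (word_qshuffle d u v).
      smult (Poly_Mapping.lookup (word_qshuffle d u v) w) (binomial_poly (length w)))
    = binomial_poly (length u) * binomial_poly (length v)"
  using linear_ext_choose_qshuffle[OF assms]
  by (intro poly_eqI_of_nat) (simp add: poly_sum poly_binomial_poly linear_ext_def)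

text \<open>
  This is the primitivity of $\overline c^0$. If the indices or levels of \<open>u\<close> and \<open>v\<close> do not fit $c$, all terms
  vanish. Otherwise no bracket between a letter of \<open>u\<close> and one of \<open>v\<close> vanishes, and the value is the
  linear coefficient of a product of two polynomials with zero constant term.
\<close>

lemma bar_coeff_word_qshuffle:
  assumes dl: "d \<le> l" and c: "c \<in> alphabet d l" and u: "u \<in> words d l" "u \<noteq> []" and v: "v \<in> words d l" "v \<noteq> []"
  shows "linear_ext (bar_coeff d l c) (word_qshuffle d u v) = 0"
proof -
  let ?X = "word_qshuffle d u v"
  have len: "total_level u \<ge> 1" "total_level v \<ge> 1"
    using total_level_ge[OF dl u(1)] total_level_ge[OF dl v(1)] u(2) v(2)
    by (cases u; cases v; simp)+
  have keys: "w \<in> words d l \<and> w \<noteq> [] \<and> index ` set w = index ` set u \<union> index ` set v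
      \<and> total_level w = total_level u + total_level v" if "w \<in> Poly_Mapping.keys ?X" for w
    using keys_word_qshuffle[OF dl u(1) v(1) that] len by auto
  show ?thesis
  proof (cases "index ` set u \<union> index ` set v \<subseteq> {index c} \<and> total_level u + total_level v = level c")
    case False
    then have "bar_coeff d l c w = 0" if "w \<in> Poly_Mapping.keys ?X" for w
      using keys[OF that] bar_coeff_hom[OF dl c, of w] by metis
    then show ?thesis by (simp add: linear_ext_def)
  next
    case True
    have nz: "letter_bracket d a b \<noteq> 0" if ab: "a \<in> set u" "b \<in> set v" for a b
    proof -
      have "level a \<le> total_level u" "level b \<le> total_level v"
        using ab by (simp_all add: total_level_def member_le_sum_list)
      moreover have "a \<in> alphabet d l" "b \<in> alphabet d l" using ab u v by (auto simp: words_def)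
      moreover have "index a = index c" "index b = index c" using ab True by auto
      ultimately show ?thesis
        using True c by (auto simp: alphabet_iff[OF dl] letter_bracket_eq)
    qed
    have "linear_ext (bar_coeff d l c) ?X = (\<Sum>w\<in>Poly_Mapping.keys ?X.
        Poly_Mapping.lookup ?X w * coeff (binomial_poly (length w)) 1)"
      unfolding linear_ext_def using keys True
      by (intro sum.cong) (auto simp: bar_coeff_hom[OF dl c])
    also have "\<dots> = coeff (binomial_poly (length u) * binomial_poly (length v)) 1"
      by (simp add: coeff_sum flip: qshuffle_binomial_poly[OF nz])
    also have "\<dots> = 0"
      using u v by (simp add: coeff_mult coeff_binomial_poly_0)
    finally show ?thesis .
  qed
qed

section \<open>Contraction as the transpose of multiplication\<close>

lemma pairing_eq: "pairing x y = linear_ext (\<lambda>w. Poly_Mapping.lookup y (map Bar w)) x"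
proof -
  have "linear_ext (\<lambda>w'. if w' = map Bar w then 1 else 0 :: real) y = Poly_Mapping.lookup y (map Bar w)" for w
    by (simp add: linear_ext_def in_keys_iff if_distrib cong: if_cong)
  then show ?thesis by (simp add: pairing_def bilinear_ext_eq)
qed

lemma linear_pairing: "linear (\<lambda>x. pairing x y)"
  unfolding pairing_eq by (rule linear_linear_ext)

lemma pairing_word_vec [simp]: "pairing (word_vec w) y = Poly_Mapping.lookup y (map Bar w)"
  by (simp add: pairing_eq)

text \<open>
  This is the operator $T_c$.
\<close>

definition bar_contract :: "nat \<Rightarrow> nat \<Rightarrow> letter \<Rightarrow> (letter list \<Rightarrow>\<^sub>0 real) \<Rightarrow> (letter list \<Rightarrow>\<^sub>0 real)" where
  "bar_contract d l c = left_contract (bar_coeff d l c)"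

lemma pairing_bar_word0_Cons:
  "pairing x (bar_word0 d l (c # v)) = pairing (bar_contract d l c x) (bar_word0 d l v)"
proof (rule linear_eq_on_words[where W = UNIV and x = x])
  show "linear (\<lambda>x. pairing (bar_contract d l c x) (bar_word0 d l v))"
    unfolding bar_contract_def by (intro linear_comp[OF linear_pairing] linear_left_contract)
  show "pairing (word_vec w) (bar_word0 d l (c # v))
      = pairing (bar_contract d l c (word_vec w)) (bar_word0 d l v)" for w
    by (simp add: bar_contract_def left_contract_word_vec linear_sum[OF linear_pairing]
        linear_scale[OF linear_pairing] bar_word0_def lookup_times_list bar_coeff_def take_map drop_map)
qed (auto intro: linear_pairing)

lemma pairing_bar_word0_Nil: "pairing x (bar_word0 d l []) = Poly_Mapping.lookup x []"
proof -
  have "bar_word0 d l [] = word_vec []" by (simp add: bar_word0_def word_vec_Nil)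
  then show ?thesis
    by (simp add: pairing_eq lookup_word_vec linear_ext_def in_keys_iff if_distrib cong: if_cong)
qed

section \<open>The dual basis\<close>

abbreviation bar_pairing :: "nat \<Rightarrow> nat \<Rightarrow> (letter list \<Rightarrow>\<^sub>0 real) \<Rightarrow> letter list \<Rightarrow> real" where
  "bar_pairing d l x v \<equiv> pairing x (bar_word0 d l v)"

lemma bar_pairing_word_Cons:
  "bar_pairing d l (word_vec w) (c # v) =
     (\<Sum>i\<le>length w. bar_coeff d l c (take i w) * bar_pairing d l (word_vec (drop i w)) v)"
  by (simp add: pairing_bar_word0_Cons bar_contract_def left_contract_word_vec
      linear_sum[OF linear_pairing] linear_scale[OF linear_pairing] del: pairing_word_vec)

text \<open>
  All words in $\overline c^0$ other than $\overline c$ have at least two letters, so $\overline v^0$ is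
  $\overline v$ plus longer words. In the induction only the prefix of length 1 of \<open>w\<close> contributes.
\<close>

lemma bar_pairing_triangular:
  assumes "v \<in> words d l" "length w \<le> length v"
  shows "bar_pairing d l (word_vec w) v = (if w = v then 1 else 0)"
  using assms
proof (induction v arbitrary: w)
  case Nil
  then show ?case by (simp add: pairing_bar_word0_Nil lookup_word_vec del: pairing_word_vec)
next
  case (Cons c v)
  have c: "c \<in> alphabet d l" and v: "v \<in> words d l" using Cons.prems by (auto simp: words_def)
  let ?f = "\<lambda>i. bar_coeff d l c (take i w) * bar_pairing d l (word_vec (drop i w)) v"
  show ?case
  proof (cases w)
    case Nil
    then show ?thesis by (simp add: bar_pairing_word_Cons bar_coeff_eq del: pairing_word_vec)
  next
    case w: (Cons a w')
    have "?f i = 0" if "i \<le> length w" "i \<noteq> 1" for i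
    proof (cases "i = 0")
      case True
      then show ?thesis by (simp add: bar_coeff_eq)
    next
      case False
      then have "length (drop i w) < length v" using that Cons.prems w by simp
      then have "bar_pairing d l (word_vec (drop i w)) v = 0"
        using Cons.IH[OF v, of "drop i w"] by (auto simp del: pairing_word_vec)
      then show ?thesis by simp
    qed
    then have "(\<Sum>i\<le>length w. ?f i) = (\<Sum>i\<in>{1}. ?f i)"
      by (intro sum.mono_neutral_right) (auto simp: w simp del: pairing_word_vec)
    also have "\<dots> = (if w = c # v then 1 else 0)"
      using Cons.IH[OF v, of w'] Cons.prems c
      by (auto simp: w bar_coeff_eq words_def simp del: pairing_word_vec)
    finally show ?thesis by (simp only: bar_pairing_word_Cons)
  qed
qed

text \<open>
  The first letter $c$ of such a \<open>v\<close> is the bracket of a nonempty prefix of \<open>w\<close>, which leaves at most one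
  choice for each of the finitely many prefixes; the rest of \<open>v\<close> pairs nontrivially with the rest of \<open>w\<close>.
\<close>

lemma finite_bar_pairing_word:
  "finite {v \<in> words d l. bar_pairing d l (word_vec w) v \<noteq> 0}"
proof (induction "length w" arbitrary: w rule: less_induct)
  case less
  let ?S = "\<lambda>w. {v \<in> words d l. bar_pairing d l (word_vec w) v \<noteq> 0}"
  let ?L = "\<lambda>u. {c. iter_bracket d u = Poly_Mapping.single c 1}"
  have finL: "finite (?L u)" for u
    by (rule finite_subset[of _ "Poly_Mapping.keys (iter_bracket d u)"]) auto
  have "?S w \<subseteq> {[]} \<union> (\<Union>i\<in>{1..length w}. (\<lambda>(c, v). c # v) ` (?L (take i w) \<times> ?S (drop i w)))"
  proof
    fix v assume v: "v \<in> ?S w"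
    show "v \<in> {[]} \<union> (\<Union>i\<in>{1..length w}. (\<lambda>(c, v). c # v) ` (?L (take i w) \<times> ?S (drop i w)))"
    proof (cases v)
      case (Cons c v')
      then have "(\<Sum>i\<le>length w. bar_coeff d l c (take i w) * bar_pairing d l (word_vec (drop i w)) v') \<noteq> 0"
        using v bar_pairing_word_Cons by auto
      then obtain i where i: "i \<le> length w" "bar_coeff d l c (take i w) \<noteq> 0"
          "bar_pairing d l (word_vec (drop i w)) v' \<noteq> 0"
        by (metis (no_types, lifting) sum.neutral mult_eq_0_iff atMost_iff)
      then have "i \<ge> 1" "c \<in> ?L (take i w)"
        by (auto simp: bar_coeff_eq Suc_le_eq split: if_splits)
      moreover have "v' \<in> words d l" using v Cons by (simp add: words_def)
      ultimately have "v \<in> (\<lambda>(c, v). c # v) ` (?L (take i w) \<times> ?S (drop i w))" "i \<in> {1..length w}"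
        using i Cons by (auto simp del: pairing_word_vec)
      then show ?thesis by blast
    qed simp
  qed
  moreover have "finite (?S (drop i w))" if "i \<in> {1..length w}" for i
    using that by (intro less) auto
  then have "finite ({[]} \<union> (\<Union>i\<in>{1..length w}. (\<lambda>(c, v). c # v) ` (?L (take i w) \<times> ?S (drop i w))))"
    by (intro finite_UnI finite_UN_I finite_imageI finite_cartesian_product finL) auto
  ultimately show ?case by (rule finite_subset)
qed

lemma subspace_word_space: "subspace (word_space d l)"
  unfolding subspace_def word_space_def
proof (intro conjI ballI allI CollectI)
  show "Poly_Mapping.keys (x + y) \<subseteq> words d l"
    if "x \<in> {x. Poly_Mapping.keys x \<subseteq> words d l}" "y \<in> {x. Poly_Mapping.keys x \<subseteq> words d l}"
    for x y :: "letter list \<Rightarrow>\<^sub>0 real"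
    using keys_add[of x y] that by blast
  show "Poly_Mapping.keys (c *\<^sub>R x) \<subseteq> words d l"
    if "x \<in> {x. Poly_Mapping.keys x \<subseteq> words d l}" for x :: "letter list \<Rightarrow>\<^sub>0 real" and c
    using keys_scaleR[of c x] that by blast
qed simp

lemma word_vec_in_word_space [simp]: "word_vec w \<in> word_space d l \<longleftrightarrow> w \<in> words d l"
  by (simp add: word_space_def)

lemma linear_ext_in_subspace:
  assumes "subspace V" "\<And>w. w \<in> Poly_Mapping.keys x \<Longrightarrow> F w \<in> V"
  shows "linear_ext F x \<in> V"
  unfolding linear_ext_def
  by (intro subspace_sum subspace_scale assms)

lemma finite_bar_pairing: "finite {v \<in> words d l. bar_pairing d l x v \<noteq> 0}"
proof (rule finite_subset)
  show "{v \<in> words d l. bar_pairing d l x v \<noteq> 0}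
    \<subseteq> (\<Union>w\<in>Poly_Mapping.keys x. {v \<in> words d l. bar_pairing d l (word_vec w) v \<noteq> 0})"
  proof
    fix v assume v: "v \<in> {v \<in> words d l. bar_pairing d l x v \<noteq> 0}"
    have "bar_pairing d l x v = linear_ext (\<lambda>w. bar_pairing d l (word_vec w) v) x"
      by (rule linear_eq_linear_ext[OF linear_pairing])
    then show "v \<in> (\<Union>w\<in>Poly_Mapping.keys x. {v \<in> words d l. bar_pairing d l (word_vec w) v \<noteq> 0})"
      using v sum.not_neutral_contains_not_neutral[of _ "Poly_Mapping.keys x"]
      unfolding linear_ext_def by (smt (verit) UN_I mem_Collect_eq scaleR_eq_0_iff)
  qed
qed (intro finite_UN_I finite_keys finite_bar_pairing_word)

text \<open>
  A longest word \<open>w\<close> of \<open>x\<close> is the only one that pairs nontrivially with $\overline w^0$, by triangularity.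
\<close>

lemma eq_0_if_bar_pairing_0:
  assumes x: "x \<in> word_space d l" and 0: "\<And>v. v \<in> words d l \<Longrightarrow> bar_pairing d l x v = 0"
  shows "x = 0"
proof (rule ccontr)
  let ?K = "Poly_Mapping.keys x"
  assume "x \<noteq> 0"
  then have "?K \<noteq> {}" by simp
  then have "Max (length ` ?K) \<in> length ` ?K" by (intro Max_in) auto
  then obtain w where w: "w \<in> ?K" and "length w = Max (length ` ?K)" by (metis imageE)
  then have max: "length u \<le> length w" if "u \<in> ?K" for u using that by simp
  have W: "w \<in> words d l" using w x by (auto simp: word_space_def)
  have "bar_pairing d l x w = linear_ext (\<lambda>u. bar_pairing d l (word_vec u) w) x"
    by (rule linear_eq_linear_ext[OF linear_pairing])
  also have "\<dots> = (\<Sum>u\<in>?K. Poly_Mapping.lookup x u * (if u = w then 1 else 0))"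
    unfolding linear_ext_def
    by (intro sum.cong refl) (simp add: bar_pairing_triangular[OF W max] del: pairing_word_vec)
  also have "\<dots> = Poly_Mapping.lookup x w" using w by (simp add: if_distrib cong: if_cong)
  finally have "Poly_Mapping.lookup x w = 0" using 0[OF W] by metis
  then show False using w by (metis in_keys_iff)
qed

lemma eq_if_bar_pairing_eq:
  assumes "x \<in> word_space d l" "y \<in> word_space d l"
    and "\<And>v. v \<in> words d l \<Longrightarrow> bar_pairing d l x v = bar_pairing d l y v"
  shows "x = y"
  using eq_0_if_bar_pairing_0[of "x - y" d l] assms
  by (simp add: subspace_diff[OF subspace_word_space] linear_diff[OF linear_pairing])

text \<open>
  The dual element is obtained by inverting the triangular matrix $\langle w, \overline v^0\rangle$: subtract from $w$
  its components along the dual elements of the shorter words.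
\<close>

lemma ex_dual_word:
  assumes "w \<in> words d l"
  shows "\<exists>x\<in>word_space d l. \<forall>v\<in>words d l. bar_pairing d l x v = (if v = w then 1 else 0)"
  using assms
proof (induction "length w" arbitrary: w rule: less_induct)
  case less
  let ?V = "{v \<in> words d l. bar_pairing d l (word_vec w) v \<noteq> 0} - {w}"
  have fin: "finite ?V" using finite_bar_pairing_word by blast
  have "length v < length w" if v: "v \<in> ?V" for v
  proof (rule ccontr)
    assume "\<not> length v < length w"
    then have "bar_pairing d l (word_vec w) v = (if w = v then 1 else 0)"
      using v by (intro bar_pairing_triangular) simp_all
    moreover have "bar_pairing d l (word_vec w) v \<noteq> 0" "w \<noteq> v" using v by blast+
    ultimately show False by metis
  qed
  then have "\<forall>v\<in>?V. \<exists>x. x \<in> word_space d l \<and> (\<forall>t\<in>words d l. bar_pairing d l x t = (if t = v then 1 else 0))"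
    using less(1) by blast
  from bchoice[OF this] obtain X where X: "\<And>v. v \<in> ?V \<Longrightarrow> X v \<in> word_space d l"
      "\<And>v t. v \<in> ?V \<Longrightarrow> t \<in> words d l \<Longrightarrow> bar_pairing d l (X v) t = (if t = v then 1 else 0)"
    by blast
  let ?x = "word_vec w - (\<Sum>v\<in>?V. bar_pairing d l (word_vec w) v *\<^sub>R X v)"
  have "?x \<in> word_space d l"
    using less(2) X(1)
    by (intro subspace_diff[OF subspace_word_space] subspace_sum[OF subspace_word_space]
        subspace_scale[OF subspace_word_space]) auto
  moreover have "bar_pairing d l ?x t = (if t = w then 1 else 0)" if t: "t \<in> words d l" for t
  proof -
    have "bar_pairing d l ?x t = bar_pairing d l (word_vec w) t
        - (\<Sum>v\<in>?V. bar_pairing d l (word_vec w) v * bar_pairing d l (X v) t)"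
      by (simp add: linear_diff[OF linear_pairing] linear_sum[OF linear_pairing]
          linear_scale[OF linear_pairing] del: pairing_word_vec)
    also have "(\<Sum>v\<in>?V. bar_pairing d l (word_vec w) v * bar_pairing d l (X v) t)
        = (\<Sum>v\<in>?V. if v = t then bar_pairing d l (word_vec w) v else 0)"
      using X(2)[OF _ t] by (intro sum.cong) auto
    also have "\<dots> = (if t \<in> ?V then bar_pairing d l (word_vec w) t else 0)"
      using fin by (simp del: pairing_word_vec)
    finally show ?thesis
      using t bar_pairing_triangular[of w d l w] less(2) by (auto simp del: pairing_word_vec)
  qed
  ultimately show ?case by blast
qed

lemma dual_word0:
  assumes "w \<in> words d l"
  shows dual_word0_in_word_space: "dual_word0 d l w \<in> word_space d l"
    and bar_pairing_dual_word0:
      "v \<in> words d l \<Longrightarrow> bar_pairing d l (dual_word0 d l w) v = (if v = w then 1 else 0)"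
proof -
  let ?P = "\<lambda>x. x \<in> word_space d l \<and> (\<forall>v\<in>words d l. bar_pairing d l x v = (if v = w then 1 else 0))"
  have "\<exists>!x. ?P x"
    using ex_dual_word[OF assms] eq_if_bar_pairing_eq[of _ d l] by (metis (no_types, lifting))
  then have "?P (dual_word0 d l w)" unfolding dual_word0_def by (rule theI')
  then show "dual_word0 d l w \<in> word_space d l"
      "v \<in> words d l \<Longrightarrow> bar_pairing d l (dual_word0 d l w) v = (if v = w then 1 else 0)"
    by blast+
qed

lemma has_formal_sum_dual_word0:
  "has_formal_sum (word_space d l) (\<lambda>w. tensor (dual_word0 d l w) (bar_word0 d l w)) (words d l) id"
  unfolding has_formal_sum_def
proof (intro ballI conjI)
  fix z assume z: "z \<in> word_space d l"
  let ?I = "{w \<in> words d l. tensor (dual_word0 d l w) (bar_word0 d l w) z \<noteq> 0}"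
  let ?V = "{v \<in> words d l. bar_pairing d l z v \<noteq> 0}"
  have "dual_word0 d l w \<noteq> 0" if "w \<in> words d l" for w
    using bar_pairing_dual_word0[OF that that] linear_0[OF linear_pairing[where y = "bar_word0 d l w"]]
    by auto
  then have I: "?I = ?V" by (auto simp: tensor_def)
  show "finite ?I" unfolding I by (rule finite_bar_pairing)
  have "(\<Sum>v\<in>?V. bar_pairing d l z v *\<^sub>R dual_word0 d l v) = z" (is "?s = z")
  proof (rule eq_if_bar_pairing_eq)
    show "?s \<in> word_space d l"
      by (intro subspace_sum[OF subspace_word_space] subspace_scale[OF subspace_word_space]
          dual_word0_in_word_space) auto
    fix t assume t: "t \<in> words d l"
    have "bar_pairing d l ?s t = (\<Sum>v\<in>?V. bar_pairing d l z v * bar_pairing d l (dual_word0 d l v) t)"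
      by (simp add: linear_sum[OF linear_pairing] linear_scale[OF linear_pairing])
    also have "\<dots> = (\<Sum>v\<in>?V. if v = t then bar_pairing d l z v else 0)"
      using bar_pairing_dual_word0[OF _ t] by (intro sum.cong) auto
    also have "\<dots> = bar_pairing d l z t"
      using t finite_bar_pairing[of d l z] by simp
    finally show "bar_pairing d l ?s t = bar_pairing d l z t" .
  qed (rule z)
  then show "(\<Sum>w\<in>?I. tensor (dual_word0 d l w) (bar_word0 d l w) z) = id z"
    unfolding I by (simp add: tensor_def)
qed

lemma has_formal_sum_word_vec:
  "has_formal_sum (word_space d l) (\<lambda>w. tensor (word_vec w) (bar_word w)) (words d l) id"
  unfolding has_formal_sum_def
proof (intro ballI conjI)
  fix z assume z: "z \<in> word_space d l"
  have t: "tensor (word_vec w) (bar_word w) z = Poly_Mapping.lookup z w *\<^sub>R word_vec w" for w :: "letter list"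
    by (simp add: tensor_def pairing_eq bar_word_def lookup_word_vec linear_ext_def in_keys_iff
        if_distrib cong: if_cong)
  have "word_vec w \<noteq> 0" for w :: "letter list" by (simp add: word_vec_def)
  then have I: "{w \<in> words d l. tensor (word_vec w) (bar_word w) z \<noteq> 0} = Poly_Mapping.keys z"
    using z unfolding t word_space_def by (auto simp del: lookup_not_eq_zero_eq_in_keys simp: in_keys_iff)
  show "finite {w \<in> words d l. tensor (word_vec w) (bar_word w) z \<noteq> 0}"
    unfolding I by simp
  show "(\<Sum>w | w \<in> words d l \<and> tensor (word_vec w) (bar_word w) z \<noteq> 0. tensor (word_vec w) (bar_word w) z) = id z"
    unfolding I using word_expansion[of z] by (simp add: t linear_ext_def)
qed

section \<open>The quasi-shuffle product in the dual basis\<close>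

lemma qshuffle_in_word_space:
  assumes "d \<le> l" "x \<in> word_space d l" "y \<in> word_space d l"
  shows "qshuffle d x y \<in> word_space d l"
  unfolding qshuffle_eq
proof (intro linear_ext_in_subspace[OF subspace_word_space])
  fix u v assume "u \<in> Poly_Mapping.keys x" "v \<in> Poly_Mapping.keys y"
  then have "u \<in> words d l" "v \<in> words d l" using assms(2,3) by (auto simp: word_space_def)
  then show "word_qshuffle d u v \<in> word_space d l"
    unfolding word_space_def using keys_word_qshuffle[OF assms(1)] by blast
qed

lemma bar_contract_in_word_space:
  assumes "x \<in> word_space d l"
  shows "bar_contract d l c x \<in> word_space d l"
  unfolding bar_contract_def left_contract_def
proof (intro linear_ext_in_subspace[OF subspace_word_space]
    subspace_sum[OF subspace_word_space] subspace_scale[OF subspace_word_space])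
  fix w i assume "w \<in> Poly_Mapping.keys x"
  then have "w \<in> words d l" using assms by (auto simp: word_space_def)
  then show "word_vec (drop i w) \<in> word_space d l"
    by (auto simp: words_def dest: in_set_dropD)
qed

lemma bar_contract_qshuffle:
  assumes dl: "d \<le> l" and c: "c \<in> alphabet d l" and x: "x \<in> word_space d l" and y: "y \<in> word_space d l"
  shows "bar_contract d l c (qshuffle d x y) = qshuffle d (bar_contract d l c x) y + qshuffle d x (bar_contract d l c y)"
    (is "?L x y = ?R x y")
proof (rule linear_eq_on_words[where W = "words d l" and x = x])
  show "linear (\<lambda>x. ?L x y)" "linear (\<lambda>x. ?R x y)"
    unfolding bar_contract_def
    by (intro linear_compose_add linear_comp[OF linear_left_contract]
        linear_comp[OF linear_qshuffle_left] linear_qshuffle_left linear_left_contract)+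
  fix u assume u: "u \<in> words d l"
  show "?L (word_vec u) y = ?R (word_vec u) y"
  proof (rule linear_eq_on_words[where W = "words d l" and x = y])
    show "linear (?L (word_vec u))" "linear (?R (word_vec u))"
      unfolding bar_contract_def
      by (intro linear_compose_add linear_comp[OF linear_left_contract]
          linear_comp[OF linear_qshuffle_right] linear_qshuffle_right linear_left_contract)+
    show "?L (word_vec u) (word_vec v) = ?R (word_vec u) (word_vec v)" if v: "v \<in> words d l" for v
      unfolding bar_contract_def qshuffle_word_vec
      by (rule left_contract_derivation[of "words d l"])
        (use u v dl c bar_coeff_word_qshuffle in \<open>auto simp: words_def bar_coeff_eq\<close>)
  qed (use y in \<open>auto simp: word_space_def\<close>)
qed (use x in \<open>auto simp: word_space_def\<close>)

text \<open>
  By transposition: $\langle T_c\,w^0, \overline v^0\rangle = \langle w^0, \overline{cv}^0\rangle$.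
\<close>

lemma bar_contract_dual_Cons:
  assumes aw: "a # w \<in> words d l" and c: "c \<in> alphabet d l"
  shows "bar_contract d l c (dual_word0 d l (a # w)) = (if c = a then dual_word0 d l w else 0)"
proof (rule eq_if_bar_pairing_eq)
  have w: "w \<in> words d l" using aw by (simp add: words_def)
  show "bar_contract d l c (dual_word0 d l (a # w)) \<in> word_space d l"
    by (intro bar_contract_in_word_space dual_word0_in_word_space aw)
  show "(if c = a then dual_word0 d l w else 0) \<in> word_space d l"
    using dual_word0_in_word_space[OF w] subspace_0[OF subspace_word_space] by auto
  show "bar_pairing d l (bar_contract d l c (dual_word0 d l (a # w))) v
      = bar_pairing d l (if c = a then dual_word0 d l w else 0) v" if "v \<in> words d l" for v
    using bar_pairing_dual_word0[OF aw, of "c # v"] bar_pairing_dual_word0[OF w that]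
      that c
    by (auto simp: words_def pairing_bar_word0_Cons linear_0[OF linear_pairing])
qed

lemma dual_word0_Nil: "dual_word0 d l [] = 1"
proof (rule eq_if_bar_pairing_eq)
  show "dual_word0 d l [] \<in> word_space d l" by (rule dual_word0_in_word_space) (simp add: words_def)
  show "1 \<in> word_space d l" by (simp add: words_def flip: word_vec_Nil)
  show "bar_pairing d l (dual_word0 d l []) v = bar_pairing d l 1 v" if "v \<in> words d l" for v
    using that bar_pairing_triangular[OF that, of "[]"] bar_pairing_dual_word0[OF _ that, of "[]"]
    by (auto simp: words_def word_vec_Nil simp del: pairing_word_vec)
qed

lemma lookup_dual_Cons_Nil:
  assumes "a # w \<in> words d l"
  shows "Poly_Mapping.lookup (dual_word0 d l (a # w)) [] = 0"
  using bar_pairing_dual_word0[OF assms, of "[]"] by (simp add: pairing_bar_word0_Nil words_def)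

text \<open>
  Every $\overline v^0$ is either the unit, whose pairing gives the coefficient of the empty word, or of the form
  $\overline c^0\,\overline{v'}^0$, whose pairing is read off after contraction with $c$.
\<close>

lemma eq_if_bar_contract_eq:
  assumes "x \<in> word_space d l" "y \<in> word_space d l"
    and "Poly_Mapping.lookup x [] = Poly_Mapping.lookup y []"
    and "\<And>c. c \<in> alphabet d l \<Longrightarrow> bar_contract d l c x = bar_contract d l c y"
  shows "x = y"
proof (rule eq_if_bar_pairing_eq)
  show "bar_pairing d l x v = bar_pairing d l y v" if "v \<in> words d l" for v
    using that assms by (cases v) (auto simp: words_def pairing_bar_word0_Nil pairing_bar_word0_Cons)
qed fact+

lemma lookup_qshuffle_Nil:
  assumes "d \<le> l" "x \<in> word_space d l" "y \<in> word_space d l" "Poly_Mapping.lookup x [] = 0"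
  shows "Poly_Mapping.lookup (qshuffle d x y) [] = 0"
proof -
  have "Poly_Mapping.lookup (word_qshuffle d u v) [] = 0"
    if "u \<in> Poly_Mapping.keys x" "v \<in> Poly_Mapping.keys y" for u v
  proof (rule ccontr)
    assume "Poly_Mapping.lookup (word_qshuffle d u v) [] \<noteq> 0"
    then have "[] \<in> Poly_Mapping.keys (word_qshuffle d u v)" by (metis in_keys_iff)
    moreover have "u \<in> words d l" "v \<in> words d l" using that assms(2,3) by (auto simp: word_space_def)
    ultimately have "index ` set ([] :: letter list) = index ` set u \<union> index ` set v"
      using keys_word_qshuffle[OF assms(1)] by blast
    then have "u = []" by simp
    then show False using that(1) assms(4) by (metis in_keys_iff)
  qed
  then show ?thesis by (simp add: qshuffle_eq linear_ext_def lookup_sum)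
qed

text \<open>
  The set \<open>shuffles p q\<close> forgets multiplicities, so the shuffled lists are lists of distinct positions, and
  \<open>a\<close> assigns letters to positions. Contraction with $c$ turns both sides into the same sum of the two
  instances in which the first position of \<open>p\<close> or of \<open>q\<close> is removed, according to which of these carries the letter $c$.
\<close>

lemma qshuffle_dual_word0:
  assumes dl: "d \<le> l"
  shows "map a p \<in> words d l \<Longrightarrow> map a q \<in> words d l \<Longrightarrow> set p \<inter> set q = {} \<Longrightarrow>
    qshuffle d (dual_word0 d l (map a p)) (dual_word0 d l (map a q))
      = (\<Sum>zs\<in>shuffles p q. dual_word0 d l (map a zs))"
proof (induction p q rule: shuffles.induct)
  case (1 ys)
  show ?case by (simp add: dual_word0_Nil)
next
  case (2 xs)
  show ?case by (simp add: dual_word0_Nil)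
next
  case (3 x xs y ys)
  let ?D = "\<lambda>zs. dual_word0 d l (map a zs)"
  let ?C = "bar_contract d l"
  have W: "map a zs \<in> words d l" if "set zs \<subseteq> set (x # xs) \<union> set (y # ys)" for zs
      proof -
    have "a ` set zs \<subseteq> a ` (set (x # xs) \<union> set (y # ys))" using that by (rule image_mono)
    also have "\<dots> \<subseteq> alphabet d l" using 3(3,4) by (auto simp: words_def)
    finally show ?thesis by (auto simp: words_def)
  qed
  have "(#) x ` shuffles xs (y # ys) \<inter> (#) y ` shuffles (x # xs) ys = {}"
    using 3(5) by auto
  then have "(\<Sum>zs\<in>shuffles (x # xs) (y # ys). ?D zs)
      = (\<Sum>zs\<in>(#) x ` shuffles xs (y # ys). ?D zs) + (\<Sum>zs\<in>(#) y ` shuffles (x # xs) ys. ?D zs)"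
    unfolding shuffles.simps by (intro sum.union_disjoint) auto
  also have "\<dots> = (\<Sum>zs\<in>shuffles xs (y # ys). ?D (x # zs)) + (\<Sum>zs\<in>shuffles (x # xs) ys. ?D (y # zs))"
    by (simp add: sum.reindex inj_on_def)
  finally have split: "(\<Sum>zs\<in>shuffles (x # xs) (y # ys). ?D zs) = \<dots>" .
  have IH: "qshuffle d (?D xs) (?D (y # ys)) = (\<Sum>zs\<in>shuffles xs (y # ys). ?D zs)"
      "qshuffle d (?D (x # xs)) (?D ys) = (\<Sum>zs\<in>shuffles (x # xs) ys. ?D zs)"
    by (rule 3(1), rule W, force, rule W, force, use 3(5) in force)
      (rule 3(2), rule W, force, rule W, force, use 3(5) in force)
  let ?L = "qshuffle d (?D (x # xs)) (?D (y # ys))"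
  let ?R = "\<Sum>zs\<in>shuffles (x # xs) (y # ys). ?D zs"
  show ?case
  proof (rule eq_if_bar_contract_eq)
    show "?L \<in> word_space d l"
      by (intro qshuffle_in_word_space dl dual_word0_in_word_space W) auto
    show "?R \<in> word_space d l"
      by (intro subspace_sum[OF subspace_word_space] dual_word0_in_word_space W)
        (auto dest: set_shuffles simp del: shuffles.simps)
    have "Poly_Mapping.lookup (?D zs) [] = 0" if "zs \<in> shuffles (x # xs) (y # ys)" for zs
    proof -
      have "map a zs \<in> words d l" by (rule W) (simp add: set_shuffles[OF that])
      moreover from set_shuffles[OF that] obtain z zs' where "zs = z # zs'" by (cases zs) auto
      ultimately show ?thesis using lookup_dual_Cons_Nil[of "a z" "map a zs'" d l] by simp
    qed
    moreover have "Poly_Mapping.lookup ?L [] = 0"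
      using 3(3,4) lookup_dual_Cons_Nil[of "a x" "map a xs" d l]
      by (intro lookup_qshuffle_Nil[OF dl] dual_word0_in_word_space) simp_all
    ultimately show "Poly_Mapping.lookup ?L [] = Poly_Mapping.lookup ?R []"
      by (simp add: lookup_sum del: shuffles.simps)
  next
    fix c assume c: "c \<in> alphabet d l"
    have lin: "linear (?C c)" unfolding bar_contract_def by (rule linear_left_contract)
    have C: "?C c (?D (z # zs)) = (if c = a z then ?D zs else 0)"
      if "set (z # zs) \<subseteq> set (x # xs) \<union> set (y # ys)" for z zs
      using bar_contract_dual_Cons[OF _ c, of "a z" "map a zs"] W[OF that] by simp
    have "?C c ?L = qshuffle d (?C c (?D (x # xs))) (?D (y # ys)) + qshuffle d (?D (x # xs)) (?C c (?D (y # ys)))"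
      by (intro bar_contract_qshuffle[OF dl c] dual_word0_in_word_space W) auto
    also have "\<dots> = (if c = a x then qshuffle d (?D xs) (?D (y # ys)) else 0)
        + (if c = a y then qshuffle d (?D (x # xs)) (?D ys) else 0)"
      by (subst (1 2) C) (simp_all add: qshuffle_linear_simps subset_iff)
    also have "\<dots> = (if c = a x then \<Sum>zs\<in>shuffles xs (y # ys). ?D zs else 0)
        + (if c = a y then \<Sum>zs\<in>shuffles (x # xs) ys. ?D zs else 0)"
      by (simp only: IH)
    also have "\<dots> = (\<Sum>zs\<in>shuffles xs (y # ys). ?C c (?D (x # zs)))
        + (\<Sum>zs\<in>shuffles (x # xs) ys. ?C c (?D (y # zs)))"
    proof -
      have "(\<Sum>zs\<in>shuffles xs (y # ys). ?C c (?D (x # zs)))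
          = (\<Sum>zs\<in>shuffles xs (y # ys). if c = a x then ?D zs else 0)"
        by (intro sum.cong refl C) (auto dest: set_shuffles)
      moreover have "(\<Sum>zs\<in>shuffles (x # xs) ys. ?C c (?D (y # zs)))
          = (\<Sum>zs\<in>shuffles (x # xs) ys. if c = a y then ?D zs else 0)"
        by (intro sum.cong refl C) (auto dest: set_shuffles)
      ultimately show ?thesis by simp
    qed
    also have "\<dots> = ?C c ?R" unfolding split by (simp add: linear_add[OF lin] linear_sum[OF lin])
    finally show "?C c ?L = ?C c ?R" .
  qed
qed

section \<open>Shuffle permutations as shuffles of lists\<close>

lemma sorted_wrt_filter_iff:
  "sorted_wrt R (filter P xs) \<longleftrightarrow> sorted_wrt (\<lambda>x y. P x \<longrightarrow> P y \<longrightarrow> R x y) xs"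
  by (induction xs) auto

text \<open>
  The values that satisfy \<open>P\<close> appear in increasing order in the list of values of $\sigma$ exactly if
  $\sigma^{-1}$, which gives their positions, is increasing on them.
\<close>

lemma sorted_filter_permutes_iff:
  fixes \<sigma> :: "nat \<Rightarrow> nat"
  assumes \<sigma>: "\<sigma> permutes {1..N}"
  shows "sorted_wrt (<) (filter P (map \<sigma> [1..<N + 1])) \<longleftrightarrow> strict_mono_on {x \<in> {1..N}. P x} (inv \<sigma>)"
proof -
  have inv: "inv \<sigma> (\<sigma> x) = x" "\<sigma> (inv \<sigma> x) = x" for x
    using permutes_inverses[OF \<sigma>] by auto
  have in1: "\<sigma> x \<in> {1..N} \<longleftrightarrow> x \<in> {1..N}" and in2: "inv \<sigma> x \<in> {1..N} \<longleftrightarrow> x \<in> {1..N}" for x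
    by (rule permutes_in_image[OF \<sigma>], rule permutes_in_image[OF permutes_inv[OF \<sigma>]])
  have "sorted_wrt (<) (filter P (map \<sigma> [1..<N + 1])) \<longleftrightarrow>
      (\<forall>i\<in>{1..N}. \<forall>j\<in>{1..N}. i < j \<longrightarrow> P (\<sigma> i) \<longrightarrow> P (\<sigma> j) \<longrightarrow> \<sigma> i < \<sigma> j)" (is "_ \<longleftrightarrow> ?pos")
  proof -
    have upt: "sorted_wrt R [a..<b] \<longleftrightarrow> (\<forall>i\<in>{a..<b}. \<forall>j\<in>{a..<b}. i < j \<longrightarrow> R i j)" for R and a b :: nat
    proof (intro iffI ballI impI)
      fix i j assume s: "sorted_wrt R [a..<b]" and ij: "i \<in> {a..<b}" "j \<in> {a..<b}" "i < j"
      have "i - a < j - a" "j - a < length [a..<b]" using ij by auto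
      then have "R ([a..<b] ! (i - a)) ([a..<b] ! (j - a))" using s sorted_wrt_nth_less by blast
      then show "R i j" using ij by simp
    next
      assume "\<forall>i\<in>{a..<b}. \<forall>j\<in>{a..<b}. i < j \<longrightarrow> R i j"
      then show "sorted_wrt R [a..<b]"
        by (intro sorted_wrt_mono_rel[OF _ sorted_wrt_upt]) auto
    qed
    have "{1..<N + 1} = {1..N}" by auto
    then show ?thesis
      unfolding sorted_wrt_filter_iff sorted_wrt_map upt by (simp only:)
  qed
  also have "\<dots> \<longleftrightarrow> strict_mono_on {x \<in> {1..N}. P x} (inv \<sigma>)"
  proof
    assume pos: ?pos
    show "strict_mono_on {x \<in> {1..N}. P x} (inv \<sigma>)"
    proof (rule strict_mono_onI)
      fix x y assume x: "x \<in> {x \<in> {1..N}. P x}" and y: "y \<in> {x \<in> {1..N}. P x}" and "x < y"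
      show "inv \<sigma> x < inv \<sigma> y"
      proof (rule ccontr)
        assume "\<not> inv \<sigma> x < inv \<sigma> y"
        moreover have "inv \<sigma> x \<noteq> inv \<sigma> y" using inv(2)[of x] inv(2)[of y] \<open>x < y\<close> by auto
        ultimately have "inv \<sigma> y < inv \<sigma> x" by simp
        moreover have "inv \<sigma> x \<in> {1..N}" "inv \<sigma> y \<in> {1..N}" using x y in2 by blast+
        moreover have "P (\<sigma> (inv \<sigma> x))" "P (\<sigma> (inv \<sigma> y))" using x y by (simp_all add: inv)
        ultimately have "\<sigma> (inv \<sigma> y) < \<sigma> (inv \<sigma> x)" using pos by blast
        then have "y < x" by (simp only: inv)
        then show False using \<open>x < y\<close> by simp
      qed
    qed
  next
    assume mono: "strict_mono_on {x \<in> {1..N}. P x} (inv \<sigma>)"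
    show ?pos
    proof (intro ballI impI, rule ccontr)
      fix i j assume ij: "i \<in> {1..N}" "j \<in> {1..N}" "i < j" "P (\<sigma> i)" "P (\<sigma> j)" "\<not> \<sigma> i < \<sigma> j"
      have "\<sigma> i \<noteq> \<sigma> j" using inv(1)[of i] inv(1)[of j] ij(3) by auto
      then have "\<sigma> j < \<sigma> i" using ij(6) by simp
      moreover have "\<sigma> i \<in> {x \<in> {1..N}. P x}" "\<sigma> j \<in> {x \<in> {1..N}. P x}" using ij in1 by blast+
      ultimately have "inv \<sigma> (\<sigma> j) < inv \<sigma> (\<sigma> i)" by (intro strict_mono_onD[OF mono])
      then show False using ij(3) by (simp add: inv)
    qed
  qed
  finally show ?thesis .
qed

lemma strict_sorted_eq_iff:
  fixes xs ys :: "nat list"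
  assumes "sorted_wrt (<) ys" "set xs = set ys"
  shows "xs = ys \<longleftrightarrow> sorted_wrt (<) xs"
  using assms strict_sorted_equal[of xs ys] by auto

text \<open>
  A list is a shuffle of two disjoint lists if it restricts to each of them. Here both are increasing, so the
  restriction conditions say that the values in each block appear in increasing order.
\<close>

lemma Sh_iff_shuffles:
  assumes \<sigma>: "\<sigma> permutes {1..n + m}"
  shows "\<sigma> \<in> Sh n m \<longleftrightarrow> map \<sigma> [1..<n + m + 1] \<in> shuffles [1..<n + 1] [n + 1..<n + m + 1]"
proof -
  let ?zs = "map \<sigma> [1..<n + m + 1]"
  have "\<sigma> ` {1..n + m} = {1..n + m}" by (rule permutes_image[OF \<sigma>])
  moreover have "set ?zs = \<sigma> ` {1..n + m}" by (auto simp: image_iff)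
  ultimately have set: "set ?zs = {1..n + m}" by (simp only:)
  have sets: "set (filter (\<lambda>x. x \<le> n) ?zs) = set [1..<n + 1]"
      "set (filter (\<lambda>x. \<not> x \<le> n) ?zs) = set [n + 1..<n + m + 1]"
    unfolding set_filter set by auto
  have blocks: "{x \<in> {1..n + m}. x \<le> n} = {1..n}" "{x \<in> {1..n + m}. \<not> x \<le> n} = {n + 1..n + m}" by auto
  have "?zs \<in> shuffles [1..<n + 1] [n + 1..<n + m + 1] \<longleftrightarrow>
      filter (\<lambda>x. x \<le> n) ?zs = [1..<n + 1] \<and> filter (\<lambda>x. \<not> x \<le> n) ?zs = [n + 1..<n + m + 1]"
    by (subst inv_image_partition[of _ "\<lambda>x. x \<le> n", symmetric]) (auto simp: o_def)
  also have "\<dots> \<longleftrightarrow> sorted_wrt (<) (filter (\<lambda>x. x \<le> n) ?zs) \<and> sorted_wrt (<) (filter (\<lambda>x. \<not> x \<le> n) ?zs)"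
    using strict_sorted_eq_iff[OF sorted_wrt_upt sets(1)] strict_sorted_eq_iff[OF sorted_wrt_upt sets(2)] by blast
  also have "\<dots> \<longleftrightarrow> \<sigma> \<in> Sh n m"
    unfolding sorted_filter_permutes_iff[OF \<sigma>] blocks using \<sigma> by (simp add: Sh_def)
  finally show ?thesis by simp
qed

lemma bij_betw_Sh_shuffles:
  "bij_betw (\<lambda>\<sigma>. map \<sigma> [1..<n + m + 1]) (Sh n m) (shuffles [1..<n + 1] [n + 1..<n + m + 1])"
  (is "bij_betw ?f _ ?S")
proof (rule bij_betw_imageI)
  have perm: "\<sigma> permutes {1..n + m}" if "\<sigma> \<in> Sh n m" for \<sigma> using that by (simp add: Sh_def)
  show "inj_on ?f (Sh n m)"
  proof (rule inj_onI, rule ext)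
    fix \<sigma> \<tau> x assume *: "\<sigma> \<in> Sh n m" "\<tau> \<in> Sh n m" "?f \<sigma> = ?f \<tau>"
    show "\<sigma> x = \<tau> x"
    proof (cases "x \<in> {1..n + m}")
      case True
      then have "x \<in> set [1..<n + m + 1]" by auto
      moreover have "\<forall>x\<in>set [1..<n + m + 1]. \<sigma> x = \<tau> x" using *(3) by (simp only: map_eq_conv)
      ultimately show ?thesis by (rule bspec[rotated])
    next
      case False
      show ?thesis
        using permutes_not_in[OF perm[OF *(1)] False] permutes_not_in[OF perm[OF *(2)] False]
        by (simp only:)
    qed
  qed
  show "?f ` Sh n m = ?S"
  proof (intro equalityI subsetI)
    fix zs assume "zs \<in> ?f ` Sh n m"
    then obtain \<sigma> where \<sigma>: "\<sigma> \<in> Sh n m" "zs = ?f \<sigma>" by (elim imageE)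
    show "zs \<in> ?S"
      using Sh_iff_shuffles[OF perm[OF \<sigma>(1)], THEN iffD1, OF \<sigma>(1)] unfolding \<sigma>(2) .
  next
    fix zs assume zs: "zs \<in> ?S"
    have dist: "distinct zs" by (rule distinct_disjoint_shuffles[OF distinct_upt distinct_upt _ zs]) (simp only: set_upt, auto)
    have "{1..<n + 1} \<union> {n + 1..<n + m + 1} = {1..n + m}" by auto
    then have set: "set zs = {1..n + m}"
      using set_shuffles[OF zs] by (simp only: set_upt)
    have len: "length zs = n + m" using length_shuffles[OF zs] by (simp del: upt_Suc)
    \<comment> \<open>Positions are counted from 1 in permutations but from 0 in lists.\<close>
    define \<sigma> where "\<sigma> = (\<lambda>i. if i \<in> {1..n + m} then zs ! (i - 1) else i)"
    have "bij_betw (\<lambda>i. i - 1) {1..n + m} {..<n + m}"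
      by (rule bij_betw_byWitness[of _ Suc]) auto
    moreover have "bij_betw ((!) zs) {..<n + m} {1..n + m}"
      by (rule bij_betw_nth[OF dist]) (simp_all add: len set)
    ultimately have "bij_betw (\<lambda>i. zs ! (i - 1)) {1..n + m} {1..n + m}"
      using bij_betw_trans[of "\<lambda>i. i - 1" "{1..n + m}" "{..<n + m}" "(!) zs"] by (simp add: o_def)
    then have "bij_betw \<sigma> {1..n + m} {1..n + m}"
      using bij_betw_cong[of "{1..n + m}" \<sigma> "\<lambda>i. zs ! (i - 1)" "{1..n + m}"]
      by (simp only: \<sigma>_def if_True)
    then have "\<sigma> permutes {1..n + m}"
      by (rule bij_imp_permutes) (auto simp: \<sigma>_def)
    moreover have "?f \<sigma> = zs"
    proof (rule nth_equalityI)
      fix k assume "k < length (?f \<sigma>)"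
      then have "k < n + m" by (simp del: upt_Suc)
      then show "?f \<sigma> ! k = zs ! k" by (simp add: \<sigma>_def nth_upt del: upt_Suc)
    qed (simp add: len del: upt_Suc)
    ultimately have "zs = ?f \<sigma>" "\<sigma> \<in> Sh n m"
      using zs Sh_iff_shuffles[of \<sigma> n m] by blast+
    then show "zs \<in> ?f ` Sh n m" by (rule image_eqI)
  qed
qed

theorem lemma5:
  fixes d l :: nat
  assumes "d \<le> l"
  shows "has_formal_sum (word_space d l) (\<lambda>w. tensor (word_vec w) (bar_word w)) (words d l) id
    \<and> has_formal_sum (word_space d l) (\<lambda>w. tensor (dual_word0 d l w) (bar_word0 d l w)) (words d l) id
    \<and> (\<forall>n m. \<forall>a :: nat \<Rightarrow> letter. (\<forall>i\<in>{1..n + m}. a i \<in> alphabet d l) \<longrightarrow>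
         qshuffle d (dual_word0 d l (map a [1..<n + 1])) (dual_word0 d l (map a [n + 1..<n + m + 1]))
         = (\<Sum>\<sigma>\<in>Sh n m. dual_word0 d l (map (\<lambda>i. a (\<sigma> i)) [1..<n + m + 1])))"
proof (intro conjI allI impI)
  fix n m and a :: "nat \<Rightarrow> letter"
  assume a: "\<forall>i\<in>{1..n + m}. a i \<in> alphabet d l"
  let ?D = "\<lambda>zs. dual_word0 d l (map a zs)"
  have "qshuffle d (?D [1..<n + 1]) (?D [n + 1..<n + m + 1])
      = (\<Sum>zs\<in>shuffles [1..<n + 1] [n + 1..<n + m + 1]. ?D zs)"
    using a by (intro qshuffle_dual_word0[OF assms]) (auto simp: words_def)
  also have "\<dots> = (\<Sum>\<sigma>\<in>Sh n m. ?D (map \<sigma> [1..<n + m + 1]))"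
    by (rule sum.reindex_bij_betw[OF bij_betw_Sh_shuffles, symmetric])
  also have "\<dots> = (\<Sum>\<sigma>\<in>Sh n m. dual_word0 d l (map (\<lambda>i. a (\<sigma> i)) [1..<n + m + 1]))"
    by (simp add: o_def del: upt_Suc)
  finally show "qshuffle d (?D [1..<n + 1]) (?D [n + 1..<n + m + 1])
      = (\<Sum>\<sigma>\<in>Sh n m. dual_word0 d l (map (\<lambda>i. a (\<sigma> i)) [1..<n + m + 1]))" .
next
  show "has_formal_sum (word_space d l) (\<lambda>w. tensor (word_vec w) (bar_word w)) (words d l) id"
    by (rule has_formal_sum_word_vec)
  show "has_formal_sum (word_space d l) (\<lambda>w. tensor (dual_word0 d l w) (bar_word0 d l w)) (words d l) id"
    by (rule has_formal_sum_dual_word0)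
qed

end
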